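(* Let $X$ be a Banach space with an unconditional basis $\{e_i\}$ such that every block-subspace of $X$ is complemented in $X$. Then $X$ is asymptotically $c_0$ or $l_p$ for some $1\le p<\infty$.
   Context: $X$ is infinite-dimensional. Supports are with respect to $\{e_i\}$. A block-subspace of $X$ is the closed linear span of an infinite sequence $(y_i)$ of norm-one finitely supported vectors with $\max\mathrm{supp}(y_i)<\min\mathrm{supp}(y_{i+1})$ for all $i$. Asymptotic game of length $n$ in $X$: for $k=1,\ldots,n$, Player I plays an integer $n_k$ and Player II then plays a finitely supported unit vector $x_k$ with $\min\mathrm{supp}(x_k)>n_k$, the vectors $x_1,x_2,\ldots$ being successive (the support of each lies before the support of the next). $X$ (with the basis $\{e_i\}$) is asymptotically $l_p$ if there is a constant $C$ such that for every $n\in\mathbb{N}$, Player I has a winning strategy in the asymptotic game of length $n$ for producing a sequence $(x_1,\ldots,x_n)$ that is $C$-equivalent to the unit vector basis of $l_p^n$. $X$ is asymptotically $c_0$ if the same holds with $l_\infty^n$ in place of $l_p^n$. Two sequences $(x_i)$, $(y_i)$ are $C$-equivalent if $x_i\mapsto y_i$ extends to an isomorphism $T$ between their closed linear spans with $\|T\|\,\|T^{-1}\|\le C$. *)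

theory Defs
  imports "HOL-Analysis.Analysis"
begin

text \<open>
  Scalars are real and bases are indexed from 0. A basis indexed by all natural numbers in which
  expansions are unique is linearly independent, so the space is infinite-dimensional.
\<close>

definition schauder_basis :: "(nat \<Rightarrow> 'a::banach) \<Rightarrow> bool" where
  "schauder_basis e \<longleftrightarrow> (\<forall>x. \<exists>!a. (\<lambda>i. a i *\<^sub>R e i) sums x)"

text \<open>
  \<^const>\<open>sums\<close> is ordered convergence of the partial sums, whereas \<^const>\<open>has_sum\<close> is convergence
  along the net of finite subsets, i.e. unconditional convergence.
\<close>

definition unconditional_basis :: "(nat \<Rightarrow> 'a::banach) \<Rightarrow> bool" where
  "unconditional_basis e \<longleftrightarrow> schauder_basis e \<and>
     (\<forall>a x. (\<lambda>i. a i *\<^sub>R e i) sums x \<longrightarrow> ((\<lambda>i. a i *\<^sub>R e i) has_sum x) UNIV)"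

definition coords :: "(nat \<Rightarrow> 'a::banach) \<Rightarrow> 'a \<Rightarrow> nat \<Rightarrow> real" where
  "coords e x = (THE a. (\<lambda>i. a i *\<^sub>R e i) sums x)"

definition supp :: "(nat \<Rightarrow> 'a::banach) \<Rightarrow> 'a \<Rightarrow> nat set" where
  "supp e x = {i. coords e x i \<noteq> 0}"

text \<open>
  Below, \<^const>\<open>Min\<close> and \<^const>\<open>Max\<close> are only applied to supports of finitely supported
  unit vectors, which are finite and nonempty.
\<close>

definition fin_supp_unit :: "(nat \<Rightarrow> 'a::banach) \<Rightarrow> 'a \<Rightarrow> bool" where
  "fin_supp_unit e x \<longleftrightarrow> finite (supp e x) \<and> norm x = 1"

definition block_subspace :: "(nat \<Rightarrow> 'a::banach) \<Rightarrow> 'a set \<Rightarrow> bool" where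
  "block_subspace e Y \<longleftrightarrow>
     (\<exists>y :: nat \<Rightarrow> 'a. (\<forall>i. fin_supp_unit e (y i)) \<and>
        (\<forall>i. Max (supp e (y i)) < Min (supp e (y (Suc i)))) \<and>
        Y = closure (span (range y)))"

definition complemented :: "'a::real_normed_vector set \<Rightarrow> bool" where
  "complemented Y \<longleftrightarrow> (\<exists>P :: 'a \<Rightarrow> 'a. bounded_linear P \<and> P \<circ> P = P \<and> range P = Y)"

text \<open>
  The space of real \<open>n\<close>-tuples, for \<open>n\<close> a term variable, consists of the sequences
  vanishing from index \<open>n\<close> on. It carries the \<open>l_p\<close> norm or the maximum norm.
\<close>

definition tuples :: "nat \<Rightarrow> (nat \<Rightarrow> real) set" where
  "tuples n = {a. \<forall>i\<ge>n. a i = 0}"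

definition lp_norm :: "real \<Rightarrow> nat \<Rightarrow> (nat \<Rightarrow> real) \<Rightarrow> real" where
  "lp_norm p n a = (\<Sum>i<n. \<bar>a i\<bar> powr p) powr (1 / p)"

definition linf_norm :: "nat \<Rightarrow> (nat \<Rightarrow> real) \<Rightarrow> real" where
  "linf_norm n a = Max (insert 0 ((\<lambda>i. \<bar>a i\<bar>) ` {..<n}))"

definition unit_tuple :: "nat \<Rightarrow> nat \<Rightarrow> real" where
  "unit_tuple i = (\<lambda>j. if j = i then 1 else 0)"

text \<open>
  \<open>C\<close>-equivalence of the finite sequence \<open>xs\<close> to the unit vector basis of the space of
  \<open>length xs\<close>-tuples under the norm \<open>N (length xs)\<close>. The two suprema are the operator norms of
  \<open>T\<close> and of its inverse, in the form of \<^const>\<open>onorm\<close> (note \<open>0 / 0 = 0\<close>). Boundedness is required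
  explicitly because the supremum of an unbounded set of reals is unspecified.
\<close>

definition equivalent_to_unit_basis ::
    "real \<Rightarrow> (nat \<Rightarrow> (nat \<Rightarrow> real) \<Rightarrow> real) \<Rightarrow> 'a::banach list \<Rightarrow> bool" where
  "equivalent_to_unit_basis C N xs \<longleftrightarrow>
     (let n = length xs; Y = closure (span (set xs)) in
      \<exists>T :: 'a \<Rightarrow> nat \<Rightarrow> real.
        (\<forall>x\<in>Y. \<forall>y\<in>Y. T (x + y) = (\<lambda>i. T x i + T y i)) \<and>
        (\<forall>c. \<forall>x\<in>Y. T (c *\<^sub>R x) = (\<lambda>i. c * T x i)) \<and>
        bij_betw T Y (tuples n) \<and>
        (\<forall>i<n. T (xs ! i) = unit_tuple i) \<and>
        bdd_above ((\<lambda>x. N n (T x) / norm x) ` Y) \<and>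
        bdd_above ((\<lambda>a. norm (inv_into Y T a) / N n a) ` tuples n) \<and>
        (SUP x\<in>Y. N n (T x) / norm x) * (SUP a\<in>tuples n. norm (inv_into Y T a) / N n a) \<le> C)"

text \<open>
  A strategy for Player I maps the list of vectors played so far by Player II to the next
  integer; \<open>legal_play e \<sigma> xs\<close> says that \<open>xs\<close> lists legal moves of Player II against \<open>\<sigma>\<close>.
\<close>

definition legal_play ::
    "(nat \<Rightarrow> 'a::banach) \<Rightarrow> ('a list \<Rightarrow> int) \<Rightarrow> 'a list \<Rightarrow> bool" where
  "legal_play e \<sigma> xs \<longleftrightarrow>
     (\<forall>k < length xs. fin_supp_unit e (xs ! k) \<and> \<sigma> (take k xs) < int (Min (supp e (xs ! k)))) \<and>
     (\<forall>k. Suc k < length xs \<longrightarrow> Max (supp e (xs ! k)) < Min (supp e (xs ! Suc k)))"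

definition player_I_wins ::
    "(nat \<Rightarrow> 'a::banach) \<Rightarrow> nat \<Rightarrow> ('a list \<Rightarrow> bool) \<Rightarrow> bool" where
  "player_I_wins e n W \<longleftrightarrow>
     (\<exists>\<sigma> :: 'a list \<Rightarrow> int. \<forall>xs. length xs = n \<and> legal_play e \<sigma> xs \<longrightarrow> W xs)"

definition asymptotically_lp :: "real \<Rightarrow> (nat \<Rightarrow> 'a::banach) \<Rightarrow> bool" where
  "asymptotically_lp p e \<longleftrightarrow>
     (\<exists>C. \<forall>n. player_I_wins e n (equivalent_to_unit_basis C (lp_norm p)))"

definition asymptotically_c0 :: "(nat \<Rightarrow> 'a::banach) \<Rightarrow> bool" where
  "asymptotically_c0 e \<longleftrightarrow>
     (\<exists>C. \<forall>n. player_I_wins e n (equivalent_to_unit_basis C linf_norm))"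

end

theory Submission
  imports Defs
begin

text \<open>
  The argument adapts Zippin's characterisation of the \<open>c\<^sub>0\<close> and \<open>l\<^sub>p\<close> bases to asymptotic games,
  fed by the Lindenstrauss-Tzafriri way of turning complemented subspaces into estimates.

  Let \<open>(u\<^sub>i)\<close> and \<open>(v\<^sub>i)\<close> be normalised, with \<open>u\<^sub>i\<close> and \<open>v\<^sub>i\<close> disjointly supported and the pairs
  successive. The vectors \<open>z\<^sub>i = u\<^sub>i + l\<^sub>i v\<^sub>i\<close>, with \<open>l\<^sub>i\<close> tending to 0, span a block subspace. A projection
  \<open>P\<close> onto it, made diagonal by averaging over signs, sends \<open>u\<^sub>i\<close> to a multiple of \<open>z\<^sub>i\<close> that cannot be
  small: \<open>P\<close> fixes \<open>z\<^sub>i\<close>, and \<open>P (l\<^sub>i v\<^sub>i)\<close> is negligible. So the \<open>u\<^sub>i\<close> dominate the \<open>z\<^sub>i\<close> and hence the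
  \<open>l\<^sub>i v\<^sub>i\<close> (lemma \<open>complemented_domination\<close>). As \<open>l\<close> may decrease arbitrarily slowly, gluing together
  worse and worse counterexamples shows that the \<open>u\<^sub>i\<close> dominate the \<open>v\<^sub>i\<close>, with one constant for
  all finite sequences of pairs that start far enough out (lemma \<open>uniform_domination\<close>).

  Two strategies of Player II can be played against each other in an interlaced way, producing such
  pairs. Thus for fixed coefficients \<open>a\<close> Player II cannot force both a small and a large value of the
  norm of \<open>\<Sum> a\<^sub>i x\<^sub>i\<close>, and Player I can confine this norm to an interval \<open>[r, D r]\<close> with \<open>D\<close> depending
  neither on \<open>a\<close> nor on the length of the game (lemma \<open>wins_stable_norm\<close>).

  Let \<open>\<lambda>(n)\<close> be the value \<open>r\<close> for \<open>n\<close> coefficients 1. The normalised sum of \<open>k\<close> consecutive moves is itself a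
  possible move, so a game of length \<open>k\<^sub>1 + ... + k\<^sub>n\<close> contains a game of length \<open>n\<close>, and the norm of
  \<open>\<Sum> \<lambda>(k\<^sub>i) y\<^sub>i\<close> is comparable to \<open>\<lambda>(k\<^sub>1 + ... + k\<^sub>n)\<close> (lemma \<open>block_estimate\<close>). With all \<open>k\<^sub>i\<close> equal this makes
  \<open>\<lambda>\<close> multiplicative up to a constant, which forces \<open>\<lambda>(n)\<close> to be comparable to \<open>n powr \<alpha>\<close> for some \<open>\<alpha>\<close>
  between 0 and 1 (lemma \<open>almost_multiplicative_imp_power\<close>). The norm of \<open>\<Sum> (k\<^sub>i powr \<alpha>) y\<^sub>i\<close> is then
  comparable to \<open>(\<Sum> k\<^sub>i) powr \<alpha>\<close> (lemma \<open>power_estimate\<close>). If \<open>\<alpha> = 0\<close>, sums of any number of moves are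
  bounded, which is \<open>c\<^sub>0\<close>. If \<open>\<alpha> > 0\<close>, this is the \<open>l\<^sub>p\<close> estimate with \<open>p = 1 / \<alpha>\<close> for the coefficients \<open>k\<^sub>i powr \<alpha>\<close>;
  finitely many of these approximate all coefficients well enough.
\<close>

section \<open>Multipliers and signs in finite sums\<close>

text \<open>
  The norm is convex, so on a cube of coefficients it is largest at a vertex. The fixed summand \<open>w\<close>
  absorbs the coordinates already treated and makes the induction go through.
\<close>

lemma norm_sum_damped_le:
  fixes v :: "'i \<Rightarrow> 'b::real_normed_vector"
  assumes "finite F" and "\<And>G. G \<subseteq> F \<Longrightarrow> norm (w + sum v G) \<le> M"
    and "\<And>i. i \<in> F \<Longrightarrow> 0 \<le> t i \<and> t i \<le> 1"
  shows "norm (w + (\<Sum>i\<in>F. t i *\<^sub>R v i)) \<le> M"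
  using assms
proof (induction F arbitrary: w rule: finite_induct)
  case empty
  from empty.prems(1)[of "{}"] show ?case by simp
next
  case (insert j F)
  let ?T = "\<Sum>i\<in>F. t i *\<^sub>R v i"
  have t: "0 \<le> t j" "t j \<le> 1"
    using insert.prems(2) by auto
  have a: "norm (w + ?T) \<le> M"
  proof (rule insert.IH)
    show "norm (w + sum v G) \<le> M" if "G \<subseteq> F" for G
      using insert.prems(1)[of G] that by blast
  qed (use insert.prems(2) in auto)
  have b: "norm ((w + v j) + ?T) \<le> M"
  proof (rule insert.IH)
    show "norm (w + v j + sum v G) \<le> M" if "G \<subseteq> F" for G
    proof -
      have "finite G" "j \<notin> G"
        using that insert.hyps finite_subset by auto
      then show ?thesis
        using insert.prems(1)[of "insert j G"] that by (simp add: add.assoc subset_insertI2 insert_mono)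
    qed
  qed (use insert.prems(2) in auto)
  have "w + (\<Sum>i\<in>insert j F. t i *\<^sub>R v i) = (1 - t j) *\<^sub>R (w + ?T) + t j *\<^sub>R ((w + v j) + ?T)"
    using insert.hyps by (simp add: algebra_simps)
  also have "norm \<dots> \<le> (1 - t j) * norm (w + ?T) + t j * norm ((w + v j) + ?T)"
    using t by (intro norm_triangle_le) simp
  also have "\<dots> \<le> (1 - t j) * M + t j * M"
    using t a b by (intro add_mono mult_left_mono) auto
  finally show ?case by (simp add: algebra_simps)
qed

text \<open>
  Positive and negative multipliers are treated separately, which costs the factor 2.
\<close>

lemma norm_sum_multiplier_le:
  fixes v :: "'i \<Rightarrow> 'b::real_normed_vector"
  assumes F: "finite F" and M: "\<And>G. G \<subseteq> F \<Longrightarrow> norm (sum v G) \<le> M"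
    and t: "\<And>i. i \<in> F \<Longrightarrow> \<bar>t i\<bar> \<le> 1"
  shows "norm (\<Sum>i\<in>F. t i *\<^sub>R v i) \<le> 2 * M"
proof -
  have 1: "norm (0 + (\<Sum>i\<in>F. max 0 (t i) *\<^sub>R v i)) \<le> M"
    by (rule norm_sum_damped_le[OF F]) (use M t in \<open>auto simp: abs_le_iff\<close>)
  have 2: "norm (0 + (\<Sum>i\<in>F. max 0 (- t i) *\<^sub>R v i)) \<le> M"
    by (rule norm_sum_damped_le[OF F]) (use M t in \<open>auto simp: abs_le_iff\<close>)
  have "(\<Sum>i\<in>F. t i *\<^sub>R v i) = (\<Sum>i\<in>F. max 0 (t i) *\<^sub>R v i) - (\<Sum>i\<in>F. max 0 (- t i) *\<^sub>R v i)"
    unfolding sum_subtractf[symmetric] scaleR_left_diff_distrib[symmetric]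
    by (rule sum.cong) (auto simp: max_def)
  then show ?thesis
    using 1 2 norm_triangle_ineq4[of "\<Sum>i\<in>F. max 0 (t i) *\<^sub>R v i" "\<Sum>i\<in>F. max 0 (- t i) *\<^sub>R v i"]
    by simp
qed

text \<open>
  The diagonal of a double sum is its average over all changes of sign \<open>s i * s m\<close>, so it is bounded by the
  largest of these double sums. The induction averages over one sign at a time.
\<close>

lemma norm_diagonal_le:
  fixes w :: "'i \<Rightarrow> 'i \<Rightarrow> 'b::real_normed_vector"
  assumes "finite F"
    and "\<And>s. (\<forall>i. s i = 1 \<or> s i = (-1::real)) \<Longrightarrow>
           norm (u + (\<Sum>i\<in>F. \<Sum>m\<in>F. (s i * s m) *\<^sub>R w i m)) \<le> M"
  shows "norm (u + (\<Sum>i\<in>F. w i i)) \<le> M"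
  using assms
proof (induction F arbitrary: u rule: finite_induct)
  case empty
  from empty.prems[of "\<lambda>_. 1"] show ?case by simp
next
  case (insert j F)
  have "norm ((u + w j j) + (\<Sum>i\<in>F. w i i)) \<le> M"
  proof (rule insert.IH)
    fix s :: "'i \<Rightarrow> real" assume s: "\<forall>i. s i = 1 \<or> s i = -1"
    define D where "D = (\<Sum>i\<in>F. \<Sum>m\<in>F. (s i * s m) *\<^sub>R w i m)"
    define r where "r = (\<Sum>i\<in>F. s i *\<^sub>R w i j) + (\<Sum>m\<in>F. s m *\<^sub>R w j m)"
    have ex: "u + (\<Sum>i\<in>insert j F. \<Sum>m\<in>insert j F. ((s(j:=c)) i * (s(j:=c)) m) *\<^sub>R w i m)
        = (u + w j j + D) + c *\<^sub>R r" if c: "c = 1 \<or> c = -1" for c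
    proof -
      have cc: "c * c = 1" using c by auto
      have ne: "i \<noteq> j" if "i \<in> F" for i using that insert.hyps by auto
      have "(\<Sum>i\<in>insert j F. \<Sum>m\<in>insert j F. ((s(j:=c)) i * (s(j:=c)) m) *\<^sub>R w i m)
        = ((c*c) *\<^sub>R w j j + (\<Sum>m\<in>F. (c * s m) *\<^sub>R w j m)) + (\<Sum>i\<in>F. (s i * c) *\<^sub>R w i j + (\<Sum>m\<in>F. (s i * s m) *\<^sub>R w i m))"
        using insert.hyps by (simp add: ne cong: sum.cong)
      also have "\<dots> = w j j + D + c *\<^sub>R r"
        unfolding D_def r_def cc
        by (simp add: sum.distrib scaleR_right_distrib scaleR_sum_right mult.commute algebra_simps)
      finally show ?thesis by (simp add: algebra_simps)
    qed
    have pc: "norm ((u + w j j + D) + c *\<^sub>R r) \<le> M" if c: "c = 1 \<or> c = -1" for c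
      unfolding ex[OF c, symmetric] by (rule insert.prems) (use s c in auto)
    have p: "norm ((u + w j j + D) + 1 *\<^sub>R r) \<le> M" "norm ((u + w j j + D) + (-1) *\<^sub>R r) \<le> M"
      using pc[of 1] pc[of "-1"] by auto
    have "2 *\<^sub>R (u + w j j + D) = ((u + w j j + D) + 1 *\<^sub>R r) + ((u + w j j + D) + (-1) *\<^sub>R r)"
      by (simp add: scaleR_2)
    then have "norm (2 *\<^sub>R (u + w j j + D)) \<le> M + M"
      by (metis add_mono norm_triangle_mono p)
    then show "norm (u + w j j + (\<Sum>i\<in>F. \<Sum>m\<in>F. (s i * s m) *\<^sub>R w i m)) \<le> M"
      unfolding D_def by simp
  qed
  then show ?case using insert.hyps by (simp add: add.assoc)
qed

section \<open>The unconditional constant\<close>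

lemma sums_coords:
  assumes "schauder_basis e"
  shows "(\<lambda>i. coords e x i *\<^sub>R e i) sums x"
proof -
  have "\<exists>!a. (\<lambda>i. a i *\<^sub>R e i) sums x"
    using assms by (simp add: schauder_basis_def)
  then show ?thesis unfolding coords_def by (rule theI')
qed

lemma coords_unique:
  assumes "schauder_basis e" "(\<lambda>i. a i *\<^sub>R e i) sums x"
  shows "coords e x = a"
proof -
  have "\<exists>!a. (\<lambda>i. a i *\<^sub>R e i) sums x"
    using assms(1) by (simp add: schauder_basis_def)
  then show ?thesis using assms(2) sums_coords[OF assms(1), of x] by blast
qed

lemma coords_add:
  assumes "schauder_basis e"
  shows "coords e (x + y) i = coords e x i + coords e y i"
  using coords_unique[OF assms, of "\<lambda>i. coords e x i + coords e y i" "x + y"]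
    sums_add[OF sums_coords[OF assms, of x] sums_coords[OF assms, of y]]
  by (simp add: scaleR_left_distrib)

lemma coords_scaleR:
  assumes "schauder_basis e"
  shows "coords e (r *\<^sub>R x) i = r * coords e x i"
  using coords_unique[OF assms, of "\<lambda>i. r * coords e x i" "r *\<^sub>R x"]
    sums_scaleR_right[OF sums_coords[OF assms, of x], of r]
  by simp

lemma linear_coords: "schauder_basis e \<Longrightarrow> linear (\<lambda>x. coords e x i)"
  by (simp add: linear_iff coords_add coords_scaleR)

lemma coords_finite_sum:
  assumes "schauder_basis e" "finite F"
  shows "coords e (\<Sum>i\<in>F. a i *\<^sub>R e i) j = (if j \<in> F then a j else 0)"
proof -
  have "(\<lambda>i. (if i \<in> F then a i else 0) *\<^sub>R e i) sums (\<Sum>i\<in>F. (if i \<in> F then a i else 0) *\<^sub>R e i)"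
    by (rule sums_finite) (use assms in auto)
  then have "coords e (\<Sum>i\<in>F. (if i \<in> F then a i else 0) *\<^sub>R e i) = (\<lambda>i. if i \<in> F then a i else 0)"
    by (rule coords_unique[OF assms(1)])
  moreover have "(\<Sum>i\<in>F. (if i \<in> F then a i else 0) *\<^sub>R e i) = (\<Sum>i\<in>F. a i *\<^sub>R e i)"
    by (rule sum.cong) auto
  ultimately show ?thesis by simp
qed

lemma basis_vector_nonzero:
  assumes "schauder_basis e"
  shows "e i \<noteq> 0"
proof
  assume "e i = 0"
  then have "(\<Sum>j\<in>{i}. 1 *\<^sub>R e j) = 0" by simp
  then have "coords e 0 i = 1"
    using coords_finite_sum[OF assms, of "{i}" "\<lambda>_. 1" i] by simp
  moreover have "coords e 0 i = 0"
    using coords_scaleR[OF assms, of 0 0 i] by simp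
  ultimately show False by simp
qed

text \<open>
  Beyond some finite set \<open>F0\<close> all finite partial sums are within 1 of \<open>x\<close>; an arbitrary one differs
  from such a sum by terms with index in \<open>F0\<close>.
\<close>

lemma unconditional_projections_pointwise_bounded:
  assumes "unconditional_basis e"
  shows "\<exists>m::nat. \<forall>F. finite F \<longrightarrow> norm (\<Sum>i\<in>F. coords e x i *\<^sub>R e i) \<le> real m"
proof -
  have sb: "schauder_basis e" using assms by (simp add: unconditional_basis_def)
  let ?v = "\<lambda>i. coords e x i *\<^sub>R e i"
  have "(?v has_sum x) UNIV"
    using assms sums_coords[OF sb] unfolding unconditional_basis_def by blast
  then have "eventually (\<lambda>F. dist (sum ?v F) x < 1) (finite_subsets_at_top UNIV)"
    by (auto simp: has_sum_def dest: tendstoD[where e=1])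
  then obtain F0 where F0: "finite F0" "\<And>F. finite F \<Longrightarrow> F0 \<subseteq> F \<Longrightarrow> dist (sum ?v F) x < 1"
    by (auto simp: eventually_finite_subsets_at_top)
  define B where "B = norm x + 1 + (\<Sum>i\<in>F0. norm (?v i))"
  have "norm (sum ?v F) \<le> B" if "finite F" for F
  proof -
    have eq: "sum ?v F = sum ?v (F \<union> F0) - sum ?v (F0 - F)"
      using sum.union_disjoint[of F "F0 - F" ?v] that F0(1) by (simp add: Un_Diff_cancel)
    have "norm (sum ?v (F \<union> F0)) \<le> norm x + 1"
      using F0(2)[of "F \<union> F0"] that F0(1) norm_triangle_sub[of "sum ?v (F \<union> F0)" x]
      by (simp add: dist_norm)
    moreover have "norm (sum ?v (F0 - F)) \<le> (\<Sum>i\<in>F0. norm (?v i))"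
      by (rule order.trans[OF norm_sum sum_mono2]) (use F0(1) in auto)
    ultimately show ?thesis
      unfolding eq B_def by (meson add_mono norm_triangle_ineq4 order_trans)
  qed
  then show ?thesis
    by (meson order.trans real_arch_simple)
qed

text \<open>
  This is Banach's theorem on the continuity of coordinates. It combines the uniform boundedness
  principle with the successive approximation known from the open mapping theorem: by Baire's theorem
  every small vector is approximated by vectors whose finite partial sums are all bounded by \<open>M\<close>, hence it is
  a series of such vectors with geometrically decreasing bounds. The coordinates of that
  series must be those of its sum because expansions are unique.
\<close>

lemma unconditional_constant:
  fixes e :: "nat \<Rightarrow> 'a::banach"
  assumes ub: "unconditional_basis e"
  obtains K where "1 \<le> K"
    "\<And>x F. finite F \<Longrightarrow> norm (\<Sum>i\<in>F. coords e x i *\<^sub>R e i) \<le> K * norm x"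
proof -
  have sb: "schauder_basis e" using ub by (simp add: unconditional_basis_def)
  define S where "S F x = (\<Sum>i\<in>F. coords e x i *\<^sub>R e i)" for F x
  have S_diff: "S F (x - y) = S F x - S F y" for F x y
    by (simp add: S_def linear_diff[OF linear_coords[OF sb]] scaleR_left_diff_distrib sum_subtractf)
  have S_scale: "S F (r *\<^sub>R x) = r *\<^sub>R S F x" for F r x
    by (simp add: S_def coords_scaleR[OF sb] scaleR_sum_right)
  define A where "A m = {x. \<forall>F. finite F \<longrightarrow> norm (S F x) \<le> m}" for m :: real
  have cover: "(\<Union>m::nat. A (real m)) = UNIV"
    using unconditional_projections_pointwise_bounded[OF ub] unfolding A_def S_def by blast
  \<comment> \<open>Baire: one of the closures of the sets \<open>A m\<close>, which cover the space, has interior points.\<close>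
  obtain m :: nat where "interior (closure (A (real m))) \<noteq> {}"
  proof (rule ccontr)
    assume "\<not> thesis"
    then have *: "\<And>m::nat. interior (closure (A (real m))) = {}" using that by blast
    have "Met_TC.mtopology interior_of \<Union> (range (\<lambda>m::nat. closure (A (real m)))) = {}"
    proof (rule Met_TC.metric_Baire_category_alt)
      show "Met_TC.mcomplete TYPE('a)"
        unfolding Met_TC.mcomplete_def by (auto simp: Cauchy_convergent_iff convergent_def)
    qed (use * in auto)
    moreover have "\<Union> (range (\<lambda>m::nat. closure (A (real m)))) = UNIV"
      using cover closure_subset by blast
    ultimately show False by simp
  qed
  then obtain x0 r where r: "r > 0" "ball x0 r \<subseteq> closure (A (real m))"
    by (metis equals0I mem_interior)
  define M where "M = 2 * real m + 1"
  have M: "M > 0" by (simp add: M_def)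
  \<comment> \<open>Differences of approximants move the ball around \<open>x0\<close> to the origin.\<close>
  have approx1: "\<exists>z\<in>A M. norm (y - z) < \<epsilon>" if y: "norm y < r" and \<epsilon>: "\<epsilon> > 0" for y \<epsilon>
  proof -
    have "x0 + y \<in> closure (A (real m))" "x0 \<in> closure (A (real m))"
      using r y by (auto simp: dist_norm subset_iff)
    then obtain p q where p: "p \<in> A (real m)" "dist p (x0 + y) < \<epsilon> / 2"
      and q: "q \<in> A (real m)" "dist q x0 < \<epsilon> / 2"
      using \<epsilon> unfolding closure_approachable by (meson half_gt_zero)
    have "norm (S F (p - q)) \<le> M" if "finite F" for F
    proof -
      have "norm (S F p) \<le> m" "norm (S F q) \<le> m" using p q that by (auto simp: A_def)
      then show ?thesis
        unfolding S_diff M_def using norm_triangle_ineq4[of "S F p" "S F q"] by simp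
    qed
    then have "p - q \<in> A M" by (simp add: A_def)
    moreover have "norm (y - (p - q)) < \<epsilon>"
    proof -
      have "y - (p - q) = ((x0 + y) - p) - (x0 - q)" by simp
      then have "norm (y - (p - q)) \<le> norm ((x0 + y) - p) + norm (x0 - q)"
        by (metis norm_triangle_ineq4)
      then show ?thesis using p(2) q(2) by (simp add: dist_norm norm_minus_commute)
    qed
    ultimately show ?thesis by blast
  qed
  have approx: "\<exists>z. z \<in> A (M * (1/2)^k) \<and> norm (y - z) < r * (1/2)^Suc k"
    if y: "norm y < r * (1/2)^k" for y k
  proof -
    have "norm (2^k *\<^sub>R y) < r"
      using y by (simp add: field_simps)
    then obtain z where z: "z \<in> A M" "norm (2^k *\<^sub>R y - z) < r / 2"
      using approx1[of "2^k *\<^sub>R y" "r/2"] r(1) by auto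
    let ?z = "(1/2)^k *\<^sub>R z"
    have "?z \<in> A (M * (1/2)^k)"
      using z(1) by (auto simp: A_def S_scale mult.commute)
    moreover have "y - ?z = (1/2)^k *\<^sub>R (2^k *\<^sub>R y - z)"
      by (simp add: scaleR_right_diff_distrib power_mult_distrib[symmetric])
    then have "norm (y - ?z) = (1/2)^k * norm (2^k *\<^sub>R y - z)"
      by (metis norm_scaleR abs_of_pos zero_less_power half_gt_zero_iff zero_less_one)
    then have "norm (y - ?z) < r * (1/2)^Suc k"
      using z(2) by (simp add: field_simps)
    ultimately show ?thesis by blast
  qed
  have key: "norm (S F y) \<le> 2 * M" if y: "norm y < r" and F: "finite F" for y F
  proof -
    \<comment> \<open>\<open>Y k\<close> is the error left after \<open>k\<close> approximation steps.\<close>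
    have "\<exists>Y. \<forall>k. norm (Y k) < r * (1/2)^k \<and> (k = 0 \<longrightarrow> Y k = y) \<and> Y k - Y (Suc k) \<in> A (M * (1/2)^k)"
    proof -
      have "\<exists>Y. \<forall>k. (norm (Y k) < r * (1/2)^k \<and> (k = 0 \<longrightarrow> Y k = y)) \<and> Y k - Y (Suc k) \<in> A (M * (1/2)^k)"
      proof (rule dependent_nat_choice)
        show "\<exists>x. norm x < r * (1/2)^0 \<and> ((0::nat) = 0 \<longrightarrow> x = y)" using y by auto
        fix x and n :: nat
        assume "norm x < r * (1/2)^n \<and> (n = 0 \<longrightarrow> x = y)"
        then obtain z where "z \<in> A (M * (1/2)^n)" "norm (x - z) < r * (1/2)^Suc n"
          using approx by blast
        then show "\<exists>y'. (norm y' < r * (1/2)^Suc n \<and> (Suc n = 0 \<longrightarrow> y' = y)) \<and> x - y' \<in> A (M * (1/2)^n)"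
          by (intro exI[of _ "x - z"]) auto
      qed
      then show ?thesis by (simp add: conj_assoc)
    qed
    then obtain Y where Y: "\<And>k. norm (Y k) < r * (1/2)^k" "Y 0 = y"
      "\<And>k. Y k - Y (Suc k) \<in> A (M * (1/2)^k)" by blast
    define z where "z k = Y k - Y (Suc k)" for k
    have Sz: "norm (S G (z k)) \<le> M * (1/2)^k" if "finite G" for G k
      using Y(3)[of k] that by (simp add: z_def A_def)
    have geo: "(\<lambda>k. M * (1/2)^k) sums (2 * M)"
      using sums_mult[OF geometric_sums[of "1/2::real"], of M] by (simp add: mult.commute)
    have Y0: "Y \<longlonglongrightarrow> 0"
    proof (rule Lim_null_comparison)
      show "(\<lambda>k. r * (1/2)^k) \<longlonglongrightarrow> 0"
        by (intro tendsto_mult_right_zero LIMSEQ_power_zero) simp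
      show "eventually (\<lambda>k. norm (Y k) \<le> r * (1/2)^k) sequentially"
        using Y(1) by (simp add: less_imp_le)
    qed
    have zs: "z sums y"
      using telescope_sums'[OF Y0] Y(2) by (simp add: z_def[abs_def])
    have Slim: "(\<lambda>n. S {..<n} x) \<longlonglongrightarrow> x" for x
      using sums_coords[OF sb, of x] by (simp add: sums_def S_def)
    have nz: "norm (z k) \<le> M * (1/2)^k" for k
      by (rule tendsto_upperbound[OF tendsto_norm[OF Slim[of "z k"]]]) (auto intro: Sz always_eventually)
    have summ_coord: "summable (\<lambda>k. coords e (z k) i)" for i
    proof (rule summable_comparison_test)
      have "\<bar>coords e (z k) i\<bar> * norm (e i) \<le> M * (1/2)^k" for k
        using Sz[of "{i}" k] by (simp add: S_def)
      then show "\<exists>N. \<forall>n\<ge>N. norm (coords e (z n) i) \<le> (M / norm (e i)) * (1/2)^n"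
        using basis_vector_nonzero[OF sb, of i] by (auto simp: field_simps)
      show "summable (\<lambda>n. (M / norm (e i)) * (1/2)^n)"
        by (intro summable_mult summable_geometric) simp
    qed
    define b where "b i = (\<Sum>k. coords e (z k) i)" for i
    have bS: "(\<lambda>k. S G (z k)) sums (\<Sum>i\<in>G. b i *\<^sub>R e i)" if "finite G" for G
      unfolding S_def b_def
      by (intro sums_sum sums_scaleR_left summable_sums summ_coord)
    \<comment> \<open>The limits of basis expansion and of approximation may be interchanged by dominated convergence.\<close>
    have bb: "(\<lambda>i. b i *\<^sub>R e i) sums y"
    proof -
      define d where "d n k = norm (S {..<n} (z k) - z k)" for n k
      have dle: "d n k \<le> 2 * M * (1/2)^k" for n k
        unfolding d_def using norm_triangle_ineq4[of "S {..<n} (z k)" "z k"] Sz[of "{..<n}" k] nz[of k]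
        by simp
      have dsum: "summable (d n)" for n
        by (rule summable_comparison_test[of _ "\<lambda>k. 2 * M * (1/2)^k"])
          (use dle in \<open>auto simp: d_def intro!: summable_mult summable_geometric\<close>)
      have "(\<lambda>n. suminf (\<lambda>k. d n k)) \<longlonglongrightarrow> suminf (\<lambda>k. 0)"
      proof (rule conjunct2[OF conjunct2[OF tannerys_theorem]])
        show "(\<lambda>n. d n k) \<longlonglongrightarrow> 0" for k
          unfolding d_def using tendsto_norm[OF tendsto_diff[OF Slim[of "z k"] tendsto_const[of "z k"]]]
          by simp
        show "eventually (\<lambda>(k,n). norm (d n k) \<le> 2 * M * (1/2)^k) (at_top \<times>\<^sub>F sequentially)"
          using dle by (intro always_eventually) (auto simp: d_def)
        show "summable (\<lambda>k. 2 * M * (1/2)^k)"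
          by (intro summable_mult summable_geometric) simp
      qed simp
      then have lim0: "(\<lambda>n. suminf (d n)) \<longlonglongrightarrow> 0" by simp
      have "norm ((\<Sum>i<n. b i *\<^sub>R e i) - y) \<le> suminf (d n)" for n
      proof -
        have "(\<lambda>k. S {..<n} (z k) - z k) sums ((\<Sum>i<n. b i *\<^sub>R e i) - y)"
          using sums_diff[OF bS zs, of "{..<n}"] by simp
        then have "norm ((\<Sum>i<n. b i *\<^sub>R e i) - y) = norm (\<Sum>k. S {..<n} (z k) - z k)"
          by (simp add: sums_iff)
        also have "\<dots> \<le> suminf (d n)"
          unfolding d_def by (rule summable_norm) (use dsum[of n] in \<open>simp add: d_def[abs_def]\<close>)
        finally show ?thesis .
      qed
      then have "(\<lambda>n. (\<Sum>i<n. b i *\<^sub>R e i) - y) \<longlonglongrightarrow> 0"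
        by (intro Lim_null_comparison[OF _ lim0]) simp
      then show ?thesis by (simp add: sums_def LIM_zero_iff)
    qed
    have "(\<lambda>k. S F (z k)) sums S F y"
      using bS[OF F] coords_unique[OF sb bb] by (simp add: S_def)
    then have "norm (S F y) = norm (\<Sum>k. S F (z k))" by (simp add: sums_iff)
    also have "\<dots> \<le> (\<Sum>k. M * (1/2)^k)"
    proof (rule norm_suminf_le)
      show "norm (S F (z k)) \<le> M * (1/2)^k" for k by (rule Sz[OF F])
      show "summable (\<lambda>k. M * (1/2)^k)" using geo by (simp add: sums_iff)
    qed
    also have "\<dots> = 2 * M" using geo by (simp add: sums_iff)
    finally show ?thesis .
  qed
  show ?thesis
  proof
    show "1 \<le> max 1 (4 * M / r)" by simp
    show "norm (\<Sum>i\<in>F. coords e x i *\<^sub>R e i) \<le> max 1 (4 * M / r) * norm x" if F: "finite F" for x F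
    proof (cases "x = 0")
      case True
      then show ?thesis using S_scale[of F 0 0] by (simp add: S_def)
    next
      case False
      define c where "c = r / (2 * norm x)"
      have c: "c > 0" using r False by (simp add: c_def)
      have "norm (c *\<^sub>R x) < r" using r False by (simp add: c_def)
      from key[OF this F] have "c * norm (S F x) \<le> 2 * M" using c by (simp add: S_scale)
      then have "norm (S F x) \<le> 4 * M / r * norm x"
        using r False by (simp add: c_def field_simps)
      also have "\<dots> \<le> max 1 (4 * M / r) * norm x" by (intro mult_right_mono) auto
      finally show ?thesis by (simp add: S_def)
    qed
  qed
qed

section \<open>Almost multiplicative sequences\<close>

text \<open>
  An additive error disappears when an inequality holds for all powers of a number.
\<close>

lemma linear_growth_bounded_imp_nonpos:
  fixes X Y :: real
  assumes "\<And>k::nat. real k * X \<le> Y"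
  shows "X \<le> 0"
proof (rule ccontr)
  assume "\<not> X \<le> 0"
  then obtain k :: nat where "Y < real k * X" using ex_less_of_nat_mult[of X Y] by auto
  with assms[of k] show False by simp
qed

text \<open>
  Put \<open>g = ln \<circ> f\<close>, which is additive on products up to \<open>b = ln B\<close>. Squeezing powers of \<open>n\<close> between
  consecutive powers of \<open>m\<close> shows that \<open>(g n - b) / ln n\<close> never exceeds \<open>(g m + 2 b) / ln m\<close>. The exponent is the
  infimum of the latter values, which are nonnegative.
\<close>

lemma almost_multiplicative_imp_power:
  fixes f :: "nat \<Rightarrow> real"
  assumes B: "1 \<le> B" and pos: "\<And>n. 1 \<le> n \<Longrightarrow> 0 < f n"
    and mono: "\<And>m n. 1 \<le> m \<Longrightarrow> m \<le> n \<Longrightarrow> f m \<le> B * f n"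
    and sub: "\<And>m n. 1 \<le> m \<Longrightarrow> 1 \<le> n \<Longrightarrow> f (m * n) \<le> B * (f m * f n)"
    and super: "\<And>m n. 1 \<le> m \<Longrightarrow> 1 \<le> n \<Longrightarrow> f m * f n \<le> B * f (m * n)"
    and le: "\<And>n. 1 \<le> n \<Longrightarrow> f n \<le> real n"
  shows "\<exists>\<alpha>. 0 \<le> \<alpha> \<and> \<alpha> \<le> 1 \<and>
    (\<forall>n\<ge>1. real n powr \<alpha> \<le> B^2 * f n \<and> f n \<le> B^2 * real n powr \<alpha>)"
proof -
  define g where "g n = ln (f n)" for n
  define b where "b = ln B"
  have b0: "0 \<le> b" using B by (simp add: b_def)
  have gmono: "g m \<le> b + g n" if "1 \<le> m" "m \<le> n" for m n
  proof -
    have "ln (f m) \<le> ln (B * f n)" using mono[OF that] pos[of m] that by (intro ln_mono) auto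
    then show ?thesis using B pos[of n] that by (simp add: ln_mult g_def b_def)
  qed
  have gsub: "g (m * n) \<le> b + (g m + g n)" if "1 \<le> m" "1 \<le> n" for m n
  proof -
    have "ln (f (m * n)) \<le> ln (B * (f m * f n))" using sub[OF that] pos[of "m * n"] that by (intro ln_mono) auto
    then show ?thesis using B pos[of n] pos[of m] that by (simp add: ln_mult g_def b_def)
  qed
  have gsuper: "g m + g n \<le> b + g (m * n)" if "1 \<le> m" "1 \<le> n" for m n
  proof -
    have "ln (f m * f n) \<le> ln (B * f (m * n))" using super[OF that] pos[of m] pos[of n] that by (intro ln_mono) auto
    then show ?thesis using B pos[of n] pos[of m] pos[of "m * n"] that by (simp add: ln_mult g_def b_def)
  qed
  have g1: "g 1 \<le> b" "- b \<le> g 1" using gsuper[of 1 1] gsub[of 1 1] by auto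
  have gnn: "0 \<le> g m + 2 * b" if "1 \<le> m" for m using gmono[of 1 m] that g1 by simp
  have pow_upper: "g (m ^ k) \<le> real k * (g m + b) + b" if "1 \<le> m" for m k
  proof (induction k)
    case (Suc k)
    have "g (m * m ^ k) \<le> b + (g m + g (m ^ k))" by (rule gsub) (use that in auto)
    then show ?case using Suc by (simp add: algebra_simps)
  qed (use g1 in simp)
  have pow_lower: "real k * (g m - b) - b \<le> g (m ^ k)" if "1 \<le> m" for m k
  proof (induction k)
    case (Suc k)
    have "g m + g (m ^ k) \<le> b + g (m * m ^ k)" by (rule gsuper) (use that in auto)
    then show ?case using Suc by (simp add: algebra_simps)
  qed (use g1 in simp)
  have cmp: "(g n - b) / ln (real n) \<le> (g m + 2 * b) / ln (real m)" if "2 \<le> m" "2 \<le> n" for m n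
  proof -
    have lnm: "0 < ln (real m)" and lnn: "0 < ln (real n)" using that by auto
    define q where "q = ln (real n) / ln (real m)"
    have q: "0 < q" using lnm lnn by (simp add: q_def)
    have "real k * ((g n - b) - q * (g m + 2 * b)) \<le> (g m + 2 * b) + 3 * b" for k
    proof -
      \<comment> \<open>The power of \<open>m\<close> with \<open>m ^ j \<le> n ^ k \<le> m ^ Suc j\<close>.\<close>
      define j where "j = nat \<lfloor>real k * q\<rfloor>"
      have j: "real j \<le> real k * q" "real k * q \<le> real (Suc j)"
        using q real_of_int_floor_add_one_ge[of "real k * q"] by (auto simp: j_def add.commute)
      have "real k * ln (real n) \<le> real (Suc j) * ln (real m)"
        using mult_right_mono[OF j(2), of "ln (real m)"] lnm by (simp add: q_def)
      then have "ln (real n ^ k) \<le> ln (real m ^ Suc j)"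
        using that by (simp only: ln_realpow)
      then have "real n ^ k \<le> real m ^ Suc j" using that by (subst (asm) ln_le_cancel_iff) auto
      then have "n ^ k \<le> m ^ Suc j" by (simp only: of_nat_power[symmetric] of_nat_le_iff)
      then have "g (n ^ k) \<le> b + g (m ^ Suc j)" using that by (intro gmono) auto
      also have "g (m ^ Suc j) \<le> real (Suc j) * (g m + b) + b" by (rule pow_upper) (use that in simp)
      also have "real (Suc j) * (g m + b) \<le> real (Suc j) * (g m + 2 * b)"
        by (intro mult_left_mono) (use b0 in auto)
      also have "real (Suc j) * (g m + 2 * b) \<le> (real k * q + 1) * (g m + 2 * b)"
        by (intro mult_right_mono) (use j gnn[of m] that in auto)
      finally have "g (n ^ k) \<le> b + ((real k * q + 1) * (g m + 2 * b) + b)" by simp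
      then show ?thesis using pow_lower[of n k] that by (simp add: algebra_simps)
    qed
    then have "(g n - b) - q * (g m + 2 * b) \<le> 0" by (rule linear_growth_bounded_imp_nonpos)
    then show ?thesis using lnm lnn by (simp add: q_def field_simps)
  qed
  define H where "H = (\<lambda>m. (g m + 2 * b) / ln (real m)) ` {2..}"
  define \<alpha> where "\<alpha> = Inf H"
  have Hne: "H \<noteq> {}" by (auto simp: H_def)
  have H0: "0 \<le> h" if "h \<in> H" for h
    using that gnn by (auto simp: H_def intro!: divide_nonneg_nonneg)
  have bH: "bdd_below H" using H0 by (auto simp: bdd_below_def)
  have a0: "0 \<le> \<alpha>" unfolding \<alpha>_def by (rule cInf_greatest[OF Hne H0])
  have up: "\<alpha> * ln (real n) \<le> g n + 2 * b" if "1 \<le> n" for n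
  proof (cases "n = 1")
    case False
    then have n: "2 \<le> n" using that by simp
    then have "\<alpha> \<le> (g n + 2 * b) / ln (real n)" unfolding \<alpha>_def
      by (intro cInf_lower[OF _ bH]) (auto simp: H_def)
    then show ?thesis using n by (simp add: field_simps)
  qed (use gnn[of 1] in simp)
  have low: "g n - b \<le> \<alpha> * ln (real n)" if "1 \<le> n" for n
  proof (cases "n = 1")
    case False
    then have n: "2 \<le> n" using that by simp
    then have "(g n - b) / ln (real n) \<le> \<alpha>" unfolding \<alpha>_def
      by (intro cInf_greatest[OF Hne]) (auto simp: H_def intro: cmp)
    then show ?thesis using n by (simp add: field_simps)
  qed (use g1 in simp)
  \<comment> \<open>An exponent above 1 would contradict \<open>f n \<le> n\<close> once \<open>ln n\<close> exceeds \<open>2 * b / (\<alpha> - 1)\<close>.\<close>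
  have a1: "\<alpha> \<le> 1"
  proof (rule ccontr)
    assume "\<not> \<alpha> \<le> 1"
    then have a: "0 < \<alpha> - 1" by simp
    obtain n :: nat where n: "exp (2 * b / (\<alpha> - 1) + 1) \<le> real n" using real_arch_simple by blast
    have n1: "1 \<le> n"
    proof (rule ccontr)
      assume "\<not> 1 \<le> n"
      then have "n = 0" by simp
      then show False using n by simp
    qed
    have "2 * b / (\<alpha> - 1) < ln (real n)"
      using n n1 by (subst (asm) ln_ge_iff[symmetric]) auto
    then have "2 * b < (\<alpha> - 1) * ln (real n)" using a by (simp add: field_simps)
    moreover have "g n \<le> ln (real n)" using le[OF n1] pos[OF n1] by (simp add: g_def)
    ultimately show False using up[OF n1] by (simp add: algebra_simps)
  qed
  have "real n powr \<alpha> \<le> B^2 * f n \<and> f n \<le> B^2 * real n powr \<alpha>" if n: "1 \<le> n" for n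
  proof
    have fe: "f n = exp (g n)" using pos[OF n] by (simp add: g_def)
    have Be: "B^2 = exp (2 * b)" using B by (simp add: b_def exp_double)
    have pe: "real n powr \<alpha> = exp (\<alpha> * ln (real n))" using n by (simp add: powr_def)
    show "real n powr \<alpha> \<le> B^2 * f n" unfolding fe Be pe exp_add[symmetric] using up[OF n] by simp
    show "f n \<le> B^2 * real n powr \<alpha>" unfolding fe Be pe exp_add[symmetric] using low[OF n] b0 by simp
  qed
  then show ?thesis using a0 a1 by blast
qed

text \<open>
  Subadditivity of a concave power: \<open>t \<le> t powr \<alpha>\<close> on the unit interval, applied to the two fractions
  \<open>x / (x + 1)\<close> and \<open>1 / (x + 1)\<close>.
\<close>

lemma powr_add_one_le:
  fixes x \<alpha> :: real
  assumes "0 \<le> x" "0 \<le> \<alpha>" "\<alpha> \<le> 1"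
  shows "(x + 1) powr \<alpha> \<le> x powr \<alpha> + 1"
proof -
  have le: "t \<le> t powr \<alpha>" if "0 \<le> t" "t \<le> 1" for t :: real
    using that assms powr_mono'[of \<alpha> 1 t] by simp
  have "1 = x / (x + 1) + 1 / (x + 1)" using assms by (simp add: field_simps)
  also have "\<dots> \<le> (x / (x + 1)) powr \<alpha> + (1 / (x + 1)) powr \<alpha>"
    using assms by (intro add_mono le) auto
  also have "\<dots> = (x powr \<alpha> + 1) / (x + 1) powr \<alpha>"
    using assms by (simp add: powr_divide add_divide_distrib)
  finally show ?thesis using assms by (simp add: field_simps)
qed

section \<open>Disjointly supported vectors\<close>

locale unconditional_space =
  fixes e :: "nat \<Rightarrow> 'a::banach" and K :: real
  assumes basis: "schauder_basis e" and K_ge_1: "1 \<le> K"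
    and projection_bound:
      "finite F \<Longrightarrow> norm (\<Sum>i\<in>F. coords e x i *\<^sub>R e i) \<le> K * norm x"
begin

definition proj :: "nat set \<Rightarrow> 'a \<Rightarrow> 'a" where
  "proj F x = (\<Sum>i\<in>F. coords e x i *\<^sub>R e i)"

lemma K_pos: "0 < K" using K_ge_1 by simp

lemma norm_proj_le: "finite F \<Longrightarrow> norm (proj F x) \<le> K * norm x"
  unfolding proj_def by (rule projection_bound)

lemma bounded_linear_coords: "bounded_linear (\<lambda>x. coords e x i)"
proof (rule bounded_linear_intro)
  show "norm (coords e x i) \<le> norm x * (K / norm (e i))" for x
    using norm_proj_le[of "{i}" x] basis_vector_nonzero[OF basis, of i]
    by (simp add: proj_def field_simps)
qed (simp_all add: coords_add[OF basis] coords_scaleR[OF basis])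

lemma bounded_linear_proj: "bounded_linear (proj F)"
  unfolding proj_def[abs_def]
  by (intro bounded_linear_sum bounded_linear_scaleR_const bounded_linear_coords)

lemmas linear_proj = bounded_linear.linear[OF bounded_linear_proj]

lemma proj_supp:
  assumes "finite F" "supp e x \<subseteq> F"
  shows "proj F x = x"
proof -
  have "(\<lambda>i. coords e x i *\<^sub>R e i) sums proj F x"
    unfolding proj_def by (rule sums_finite) (use assms in \<open>auto simp: supp_def\<close>)
  then show ?thesis using sums_coords[OF basis, of x] sums_unique2 by blast
qed

lemma proj_disjoint: "supp e x \<inter> F = {} \<Longrightarrow> proj F x = 0"
  unfolding proj_def by (rule sum.neutral) (auto simp: supp_def)

lemma supp_proj: "finite F \<Longrightarrow> supp e (proj F x) \<subseteq> F"
  unfolding supp_def proj_def by (auto simp: coords_finite_sum[OF basis] split: if_splits)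

lemma supp_scaleR_subset: "supp e (r *\<^sub>R x) \<subseteq> supp e x"
  by (auto simp: supp_def coords_scaleR[OF basis])

lemma supp_scaleR: "r \<noteq> 0 \<Longrightarrow> supp e (r *\<^sub>R x) = supp e x"
  by (auto simp: supp_def coords_scaleR[OF basis])

lemma supp_sum_subset: "supp e (\<Sum>i\<in>I. f i) \<subseteq> (\<Union>i\<in>I. supp e (f i))"
proof -
  have "coords e (\<Sum>i\<in>I. f i) j = (\<Sum>i\<in>I. coords e (f i) j)" for j
    by (rule linear_sum[OF linear_coords[OF basis]])
  then show ?thesis
    by (auto simp: supp_def dest: sum.not_neutral_contains_not_neutral)
qed

lemma supp_nonempty: "x \<noteq> 0 \<Longrightarrow> supp e x \<noteq> {}"
  using proj_supp[of "{}" x] by (auto simp: proj_def)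

lemma proj_sum_disjoint:
  assumes I: "finite I" and fin: "\<And>i. i \<in> I \<Longrightarrow> finite (supp e (x i))"
    and disj: "\<And>i j. i \<in> I \<Longrightarrow> j \<in> I \<Longrightarrow> i \<noteq> j \<Longrightarrow> supp e (x i) \<inter> supp e (x j) = {}"
    and G: "G \<subseteq> I"
  shows "proj (\<Union>i\<in>G. supp e (x i)) (\<Sum>i\<in>I. a i *\<^sub>R x i) = (\<Sum>i\<in>G. a i *\<^sub>R x i)"
proof -
  let ?F = "\<Union>i\<in>G. supp e (x i)"
  have finF: "finite ?F" using I G fin finite_subset by blast
  have "proj ?F (\<Sum>i\<in>I. a i *\<^sub>R x i) = (\<Sum>i\<in>I. a i *\<^sub>R proj ?F (x i))"
    by (simp add: linear_sum[OF linear_proj] linear_scale[OF linear_proj])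
  also have "\<dots> = (\<Sum>i\<in>I. if i \<in> G then a i *\<^sub>R x i else 0)"
  proof (rule sum.cong[OF refl])
    fix i assume i: "i \<in> I"
    show "a i *\<^sub>R proj ?F (x i) = (if i \<in> G then a i *\<^sub>R x i else 0)"
    proof (cases "i \<in> G")
      case True
      then show ?thesis using proj_supp[OF finF, of "x i"] by auto
    next
      case False
      then have "supp e (x i) \<inter> ?F = {}" using disj[OF i] G by blast
      then show ?thesis using proj_disjoint False by simp
    qed
  qed
  also have "\<dots> = (\<Sum>i\<in>G. a i *\<^sub>R x i)"
    using sum.inter_restrict[OF I, of "\<lambda>i. a i *\<^sub>R x i" G] G by (simp add: Int_absorb1)
  finally show ?thesis .
qed

lemma norm_subsum_le:
  assumes I: "finite I" and fin: "\<And>i. i \<in> I \<Longrightarrow> finite (supp e (x i))"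
    and disj: "\<And>i j. i \<in> I \<Longrightarrow> j \<in> I \<Longrightarrow> i \<noteq> j \<Longrightarrow> supp e (x i) \<inter> supp e (x j) = {}"
    and G: "G \<subseteq> I"
  shows "norm (\<Sum>i\<in>G. a i *\<^sub>R x i) \<le> K * norm (\<Sum>i\<in>I. a i *\<^sub>R x i)"
proof -
  have "finite (\<Union>i\<in>G. supp e (x i))" using I G fin finite_subset by blast
  note bound = norm_proj_le[OF this, of "\<Sum>i\<in>I. a i *\<^sub>R x i"]
  have "proj (\<Union>i\<in>G. supp e (x i)) (\<Sum>i\<in>I. a i *\<^sub>R x i) = (\<Sum>i\<in>G. a i *\<^sub>R x i)"
    by (rule proj_sum_disjoint) (use assms in auto)
  with bound show ?thesis by simp
qed

lemma coefficient_le: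
  assumes "finite I" "\<And>i. i \<in> I \<Longrightarrow> finite (supp e (x i))"
    "\<And>i j. i \<in> I \<Longrightarrow> j \<in> I \<Longrightarrow> i \<noteq> j \<Longrightarrow> supp e (x i) \<inter> supp e (x j) = {}" "i \<in> I"
  shows "\<bar>a i\<bar> * norm (x i) \<le> K * norm (\<Sum>i\<in>I. a i *\<^sub>R x i)"
  using norm_subsum_le[OF assms(1-3), where G="{i}" and a=a] assms(4) by simp

text \<open>
  Sums over subsets of \<open>I\<close> are coordinate projections of the whole sum, so multipliers of modulus at
  most 1 cost the factor \<open>2 * K\<close>.
\<close>

lemma norm_sum_mono:
  assumes I: "finite I" and fin: "\<And>i. i \<in> I \<Longrightarrow> finite (supp e (x i))"
    and disj: "\<And>i j. i \<in> I \<Longrightarrow> j \<in> I \<Longrightarrow> i \<noteq> j \<Longrightarrow> supp e (x i) \<inter> supp e (x j) = {}"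
    and ba: "\<And>i. i \<in> I \<Longrightarrow> \<bar>b i\<bar> \<le> \<bar>a i\<bar>"
  shows "norm (\<Sum>i\<in>I. b i *\<^sub>R x i) \<le> 2 * K * norm (\<Sum>i\<in>I. a i *\<^sub>R x i)"
proof -
  have "norm (\<Sum>i\<in>I. (b i / a i) *\<^sub>R (a i *\<^sub>R x i)) \<le> 2 * (K * norm (\<Sum>i\<in>I. a i *\<^sub>R x i))"
  proof (rule norm_sum_multiplier_le[OF I])
    show "norm (\<Sum>i\<in>G. a i *\<^sub>R x i) \<le> K * norm (\<Sum>i\<in>I. a i *\<^sub>R x i)" if "G \<subseteq> I" for G
      by (rule norm_subsum_le[OF I fin disj that])
    show "\<bar>b i / a i\<bar> \<le> 1" if "i \<in> I" for i
      using ba[OF that] by (cases "a i = 0") (auto simp: abs_divide field_simps)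
  qed
  moreover have "(\<Sum>i\<in>I. (b i / a i) *\<^sub>R (a i *\<^sub>R x i)) = (\<Sum>i\<in>I. b i *\<^sub>R x i)"
    by (rule sum.cong) (use ba in fastforce)+
  ultimately show ?thesis by simp
qed

section \<open>Domination between disjointly supported block sequences\<close>

lemma in_closure_span_linear_eq:
  assumes "bounded_linear f" "bounded_linear g" "\<And>x. x \<in> A \<Longrightarrow> f x = g x"
    "x \<in> closure (span A)"
  shows "f x = (g x :: 'b::real_normed_vector)"
proof -
  have lin: "linear f" "linear g" using assms bounded_linear.linear by auto
  have "span A \<subseteq> {x. f x = g x}"
    using linear_eq_on_span[OF lin assms(3)] by blast
  moreover have "closed {x. f x = g x}"
    by (intro closed_Collect_eq linear_continuous_on assms(1,2))
  ultimately have "closure (span A) \<subseteq> {x. f x = g x}"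
    by (rule closure_minimal)
  then show ?thesis using assms(4) by blast
qed

text \<open>
  The vectors \<open>z i = u i + l i *\<^sub>R v i\<close> span a complemented block subspace. Writing \<open>P\<close> for the projection, its
  diagonal coefficient on \<open>u i\<close> and \<open>l i\<close> times its diagonal coefficient on \<open>v i\<close> add up to that of \<open>z i\<close>; since
  \<open>l i\<close> tends to 0, the first is eventually at least half of the total.
\<close>

lemma complemented_domination:
  fixes u v :: "nat \<Rightarrow> 'a" and l :: "nat \<Rightarrow> real"
  defines "S \<equiv> \<lambda>i. supp e (u i) \<union> supp e (v i)"
  assumes compl: "\<And>Y. block_subspace e Y \<Longrightarrow> complemented Y"
    and u: "\<And>i. fin_supp_unit e (u i)" and v: "\<And>i. fin_supp_unit e (v i)"
    and disj: "\<And>i. supp e (u i) \<inter> supp e (v i) = {}"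
    and succ: "\<And>i j p q. i < j \<Longrightarrow> p \<in> S i \<Longrightarrow> q \<in> S j \<Longrightarrow> p < q"
    and l: "\<And>i. 0 < l i" "l \<longlonglongrightarrow> 0"
  shows "\<exists>C N. \<forall>F a. finite F \<and> F \<subseteq> {N..} \<longrightarrow>
           norm (\<Sum>i\<in>F. (a i * l i) *\<^sub>R v i) \<le> C * norm (\<Sum>i\<in>F. a i *\<^sub>R u i)"
proof -
  have fin: "finite (supp e (u i))" "finite (supp e (v i))" and n1: "norm (u i) = 1" "norm (v i) = 1" for i
    using u v by (auto simp: fin_supp_unit_def)
  have ne: "supp e (u i) \<noteq> {}" for i using supp_nonempty[of "u i"] n1(1)[of i] by (metis norm_zero zero_neq_one)
  have finS: "finite (S i)" and neS: "S i \<noteq> {}" for i using fin ne by (auto simp: S_def)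
  have Sdisj: "S i \<inter> S j = {}" if "i \<noteq> j" for i j
    using succ[of i j] succ[of j i] that by (metis disjoint_iff less_irrefl linorder_neqE_nat)
  define z where "z i = u i + l i *\<^sub>R v i" for i
  have suppz: "supp e (z i) = S i" for i
  proof -
    have "coords e (u i) j = 0 \<or> coords e (v i) j = 0" for j
      using disj[of i] by (auto simp: supp_def)
    then show ?thesis
      using l(1)[of i]
      by (fastforce simp: z_def S_def supp_def coords_add[OF basis] coords_scaleR[OF basis])
  qed
  have proju: "proj (supp e (u i)) (z i) = u i" for i
  proof -
    have "proj (supp e (u i)) (z i) = proj (supp e (u i)) (u i) + l i *\<^sub>R proj (supp e (u i)) (v i)"
      by (simp add: z_def linear_add[OF linear_proj] linear_scale[OF linear_proj])
    moreover have "proj (supp e (u i)) (v i) = 0" by (rule proj_disjoint) (use disj in blast)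
    ultimately show ?thesis by (simp add: proj_supp fin)
  qed
  have nz: "1 / K \<le> norm (z i)" for i
    using norm_proj_le[OF fin(1), of i "z i"] proju n1(1)[of i] K_pos by (simp add: field_simps)
  then have nzp: "0 < norm (z i)" for i using K_pos less_le_trans zero_less_divide_1_iff by blast
  define y where "y i = (1 / norm (z i)) *\<^sub>R z i" for i
  have zy: "z i = norm (z i) *\<^sub>R y i" for i using nzp[of i] by (simp add: y_def)
  have suppy: "supp e (y i) = S i" for i
    unfolding y_def suppz[symmetric] by (rule supp_scaleR) (use nzp[of i] in simp)
  have ny: "norm (y i) = 1" for i using nzp[of i] by (simp add: y_def)
  define Z where "Z = closure (span (range y))"
  have "block_subspace e Z"
    unfolding block_subspace_def Z_def
  proof (intro exI[of _ y] conjI allI refl)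
    show "fin_supp_unit e (y i)" for i using ny finS suppy by (simp add: fin_supp_unit_def)
    show "Max (supp e (y i)) < Min (supp e (y (Suc i)))" for i
      unfolding suppy using succ[of i "Suc i"] Max_in[OF finS neS] Min_in[OF finS neS] by blast
  qed
  then obtain P where P: "bounded_linear P" "P \<circ> P = P" "range P = Z"
    using compl unfolding complemented_def by blast
  have PZ: "P x = x" if "x \<in> Z" for x
    using that P(2,3) by (metis comp_apply imageE)
  have yZ: "y i \<in> Z" for i
    unfolding Z_def by (rule closure_subset[THEN subsetD], rule span_base) simp
  obtain B where B: "B > 0" "\<And>x. norm (P x) \<le> norm x * B"
    using bounded_linear.pos_bounded[OF P(1)] by blast
  \<comment> \<open>Any point of the support of \<open>y i\<close> yields a functional that reads off the coefficient of \<open>y i\<close>.\<close>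
  define s where "s i = Min (S i)" for i
  have s: "s i \<in> S i" for i unfolding s_def by (rule Min_in[OF finS neS])
  define \<phi> where "\<phi> i x = coords e x (s i) / coords e (y i) (s i)" for i x
  have ys: "coords e (y i) (s i) \<noteq> 0" for i using s suppy by (auto simp: supp_def)
  have \<phi>lin: "bounded_linear (\<phi> i)" for i
    unfolding \<phi>_def[abs_def] by (rule bounded_linear_divide[THEN bounded_linear_compose, OF bounded_linear_coords])
  have \<phi>y: "\<phi> i (y j) = (if i = j then 1 else 0)" for i j
  proof (cases "i = j")
    case False
    then have "s i \<notin> supp e (y j)" using s[of i] Sdisj[OF False] suppy by blast
    then show ?thesis using False by (simp add: \<phi>_def supp_def)
  qed (use ys in \<open>simp add: \<phi>_def\<close>)
  have projZ: "proj (S i) x = \<phi> i x *\<^sub>R y i" if "x \<in> Z" for i x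
  proof (rule in_closure_span_linear_eq[OF bounded_linear_proj _ _ that[unfolded Z_def]])
    show "bounded_linear (\<lambda>x. \<phi> i x *\<^sub>R y i)"
      by (rule bounded_linear_scaleR_const[OF \<phi>lin])
    show "proj (S i) x = \<phi> i x *\<^sub>R y i" if "x \<in> range y" for x
    proof -
      from that obtain j where x: "x = y j" by auto
      show ?thesis
      proof (cases "i = j")
        case True
        then show ?thesis using proj_supp[OF finS, of x i] suppy x \<phi>y by simp
      next
        case False
        then show ?thesis using proj_disjoint[of x "S i"] suppy x \<phi>y Sdisj by simp
      qed
    qed
  qed
  define c where "c i = \<phi> i (P (u i))" for i
  have inZ: "P x \<in> Z" for x using P(3) by blast
  \<comment> \<open>\<open>P\<close> fixes \<open>z i\<close>, so \<open>c i\<close> misses \<open>norm (z i)\<close> only by the contribution of \<open>l i *\<^sub>R v i\<close>.\<close>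
  have c_ge: "norm (z i) / 2 \<le> c i" if "l i \<le> 1 / (2 * K^2 * B)" for i
  proof -
    have "P (z i) = z i"
      using PZ[OF yZ[of i]] zy[of i] bounded_linear.linear[OF P(1)] by (metis linear_scale)
    then have "\<phi> i (P (u i)) + l i * \<phi> i (P (v i)) = \<phi> i (z i)"
      using linear_add[OF bounded_linear.linear[OF P(1)], of "u i" "l i *\<^sub>R v i"]
        linear_scale[OF bounded_linear.linear[OF P(1)], of "l i" "v i"]
        linear_add[OF bounded_linear.linear[OF \<phi>lin[of i]], of "P (u i)" "l i *\<^sub>R P (v i)"]
        linear_scale[OF bounded_linear.linear[OF \<phi>lin[of i]], of "l i" "P (v i)"]
      by (simp add: z_def)
    moreover have "\<phi> i (z i) = norm (z i)"
      using linear_scale[OF bounded_linear.linear[OF \<phi>lin[of i]], of "norm (z i)" "y i"] zy[of i] \<phi>y[of i i]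
      by simp
    moreover have "l i * \<phi> i (P (v i)) \<le> norm (z i) / 2"
    proof -
      have "\<bar>\<phi> i (P (v i))\<bar> = norm (proj (S i) (P (v i)))"
        using projZ[OF inZ[of "v i"], of i] ny[of i] by simp
      also have "\<dots> \<le> K * norm (P (v i))" by (rule norm_proj_le[OF finS])
      also have "\<dots> \<le> K * B" using B(2)[of "v i"] n1 K_pos by (intro mult_left_mono) auto
      finally have "\<bar>\<phi> i (P (v i))\<bar> \<le> K * B" .
      then have "\<phi> i (P (v i)) \<le> K * B" by simp
      then have "l i * \<phi> i (P (v i)) \<le> l i * (K * B)" using l(1)[of i] by (intro mult_left_mono) auto
      also have "\<dots> \<le> 1 / (2 * K^2 * B) * (K * B)"
        using that K_pos B(1) by (intro mult_right_mono) auto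
      also have "\<dots> = (1 / K) / 2" using K_pos B(1) by (simp add: field_simps power2_eq_square)
      also have "\<dots> \<le> norm (z i) / 2" using nz[of i] by simp
      finally show ?thesis .
    qed
    ultimately show ?thesis by (simp add: c_def)
  qed
  \<comment> \<open>Averaging over signs removes the off-diagonal part of \<open>P\<close>.\<close>
  have diag: "norm (\<Sum>i\<in>F. (a i * c i) *\<^sub>R y i) \<le> 4 * K^3 * B * norm (\<Sum>i\<in>F. a i *\<^sub>R u i)"
    if F: "finite F" for F a
  proof -
    let ?w = "\<lambda>i m. proj (S i) (P (a m *\<^sub>R u m))"
    have wii: "?w i i = (a i * c i) *\<^sub>R y i" for i
      using projZ[OF inZ[of "u i"], of i]
      by (simp add: c_def linear_scale[OF bounded_linear.linear[OF P(1)]] linear_scale[OF linear_proj])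
    have "norm (0 + (\<Sum>i\<in>F. ?w i i)) \<le> 4 * K^3 * B * norm (\<Sum>i\<in>F. a i *\<^sub>R u i)"
    proof (rule norm_diagonal_le[OF F, where w = ?w and u = 0])
      fix t :: "nat \<Rightarrow> real" assume t: "\<forall>i. t i = 1 \<or> t i = -1"
      then have t1: "\<bar>t i\<bar> = 1" for i by (metis abs_minus_cancel abs_one)
      define x where "x = P (\<Sum>m\<in>F. (t m * a m) *\<^sub>R u m)"
      have "norm (\<Sum>i\<in>F. t i *\<^sub>R proj (S i) x) \<le> 2 * K * norm (\<Sum>i\<in>F. 1 *\<^sub>R proj (S i) x)"
      proof (rule norm_sum_mono[OF F])
        show "finite (supp e (proj (S i) x))" for i using supp_proj[OF finS] finS finite_subset by blast
        show "supp e (proj (S i) x) \<inter> supp e (proj (S j) x) = {}" if "i \<noteq> j" for i j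
          using supp_proj[OF finS] Sdisj[OF that] by blast
      qed (use t1 in auto)
      moreover have "(\<Sum>i\<in>F. 1 *\<^sub>R proj (S i) x) = proj (\<Union>i\<in>F. S i) x"
        unfolding proj_def scaleR_one
        by (rule sum.UNION_disjoint[symmetric]) (use F finS Sdisj in auto)
      moreover have "norm (proj (\<Union>i\<in>F. S i) x) \<le> K * norm x"
        by (rule norm_proj_le) (use F finS in auto)
      moreover have "norm x \<le> B * norm (\<Sum>m\<in>F. (t m * a m) *\<^sub>R u m)"
        using B(2) unfolding x_def by (simp add: mult.commute)
      moreover have "norm (\<Sum>m\<in>F. (t m * a m) *\<^sub>R u m) \<le> 2 * K * norm (\<Sum>m\<in>F. a m *\<^sub>R u m)"
        by (rule norm_sum_mono[OF F fin(1)])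
          (use Sdisj in \<open>auto simp: S_def t1 abs_mult disjoint_iff\<close>)
      ultimately have "norm (\<Sum>i\<in>F. t i *\<^sub>R proj (S i) x)
          \<le> 2 * K * (K * (B * (2 * K * norm (\<Sum>m\<in>F. a m *\<^sub>R u m))))"
        using K_pos B(1) by (smt (verit) mult_left_mono)
      moreover have "(\<Sum>i\<in>F. \<Sum>m\<in>F. (t i * t m) *\<^sub>R ?w i m) = (\<Sum>i\<in>F. t i *\<^sub>R proj (S i) x)"
        unfolding x_def
        by (simp add: linear_sum[OF bounded_linear.linear[OF P(1)]] linear_sum[OF linear_proj]
              linear_scale[OF bounded_linear.linear[OF P(1)]] linear_scale[OF linear_proj] scaleR_sum_right mult.assoc)
      ultimately show "norm (0 + (\<Sum>i\<in>F. \<Sum>m\<in>F. (t i * t m) *\<^sub>R ?w i m))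
          \<le> 4 * K^3 * B * norm (\<Sum>i\<in>F. a i *\<^sub>R u i)"
        by (simp add: power3_eq_cube mult_ac)
    qed
    then show ?thesis by (simp add: wii)
  qed
  have "eventually (\<lambda>i. l i < 1 / (2 * K^2 * B)) sequentially"
    by (rule order_tendstoD(2)[OF l(2)]) (use K_pos B(1) in simp)
  then obtain N where N: "\<And>i. i \<ge> N \<Longrightarrow> l i \<le> 1 / (2 * K^2 * B)"
    unfolding eventually_sequentially by (meson less_imp_le)
  show ?thesis
  proof (intro exI allI impI)
    fix F a assume F: "finite F \<and> F \<subseteq> {N..}"
    let ?V = "\<Union>i\<in>F. supp e (v i)"
    have "proj ?V (\<Sum>i\<in>F. a i *\<^sub>R z i) = (\<Sum>i\<in>F. a i *\<^sub>R proj ?V (z i))"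
      by (simp add: linear_sum[OF linear_proj] linear_scale[OF linear_proj])
    also have "\<dots> = (\<Sum>i\<in>F. (a i * l i) *\<^sub>R v i)"
    proof (rule sum.cong[OF refl])
      fix i assume i: "i \<in> F"
      have "supp e (u i) \<inter> supp e (v j) = {}" for j
        using disj[of i] Sdisj[of i j] by (cases "i = j") (auto simp: S_def)
      then have "proj ?V (u i) = 0" by (intro proj_disjoint) auto
      moreover have "proj ?V (v i) = v i" by (rule proj_supp) (use i F fin in auto)
      ultimately show "a i *\<^sub>R proj ?V (z i) = (a i * l i) *\<^sub>R v i"
        by (simp add: z_def linear_add[OF linear_proj] linear_scale[OF linear_proj])
    qed
    finally have 1: "norm (\<Sum>i\<in>F. (a i * l i) *\<^sub>R v i) \<le> K * norm (\<Sum>i\<in>F. a i *\<^sub>R z i)"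
      using norm_proj_le[of ?V "\<Sum>i\<in>F. a i *\<^sub>R z i"] F fin by auto
    have "(\<Sum>i\<in>F. a i *\<^sub>R z i) = (\<Sum>i\<in>F. (a i * norm (z i)) *\<^sub>R y i)"
      by (subst zy) simp
    also have "norm \<dots> \<le> 2 * K * norm (\<Sum>i\<in>F. (2 * (a i * c i)) *\<^sub>R y i)"
    proof (rule norm_sum_mono)
      show "\<bar>a i * norm (z i)\<bar> \<le> \<bar>2 * (a i * c i)\<bar>" if "i \<in> F" for i
      proof -
        have "norm (z i) / 2 \<le> c i" using c_ge[OF N] that F by auto
        then have "norm (z i) \<le> 2 * \<bar>c i\<bar>" by linarith
        then have "\<bar>a i\<bar> * norm (z i) \<le> \<bar>a i\<bar> * (2 * \<bar>c i\<bar>)" by (intro mult_left_mono) auto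
        then show ?thesis by (simp add: abs_mult)
      qed
    qed (use F finS Sdisj suppy in auto)
    finally have 2: "norm (\<Sum>i\<in>F. a i *\<^sub>R z i) \<le> 2 * K * norm (\<Sum>i\<in>F. (2 * (a i * c i)) *\<^sub>R y i)" .
    have "(\<Sum>i\<in>F. (2 * (a i * c i)) *\<^sub>R y i) = 2 *\<^sub>R (\<Sum>i\<in>F. (a i * c i) *\<^sub>R y i)"
      by (simp add: scaleR_sum_right)
    then have 3: "norm (\<Sum>i\<in>F. (2 * (a i * c i)) *\<^sub>R y i) \<le> 2 * (4 * K^3 * B * norm (\<Sum>i\<in>F. a i *\<^sub>R u i))"
      using diag[of F a] F by (simp add: mult_ac)
    have "norm (\<Sum>i\<in>F. (a i * l i) *\<^sub>R v i)
        \<le> K * (2 * K * (2 * (4 * K^3 * B * norm (\<Sum>i\<in>F. a i *\<^sub>R u i))))"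
      using 1 2 3 K_pos by (smt (verit) mult_left_mono)
    then show "norm (\<Sum>i\<in>F. (a i * l i) *\<^sub>R v i)
        \<le> (16 * K^5 * B) * norm (\<Sum>i\<in>F. a i *\<^sub>R u i)"
      by (simp add: eval_nat_numeral mult_ac)
  qed
qed

definition pair_supp :: "'a \<times> 'a \<Rightarrow> nat set" where
  "pair_supp p = supp e (fst p) \<union> supp e (snd p)"

definition block_pair :: "'a \<times> 'a \<Rightarrow> bool" where
  "block_pair p \<longleftrightarrow> fin_supp_unit e (fst p) \<and> fin_supp_unit e (snd p) \<and>
     supp e (fst p) \<inter> supp e (snd p) = {}"

text \<open>
  Disjoint supports within a pair \<open>(u, v)\<close> let unconditionality separate \<open>u\<close> from \<open>v\<close> inside \<open>u + l *\<^sub>R v\<close>;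
  the order between the pairs makes these vectors a block sequence.
\<close>

definition successive_pairs :: "nat \<Rightarrow> ('a \<times> 'a) list \<Rightarrow> bool" where
  "successive_pairs N ps \<longleftrightarrow> (\<forall>p\<in>set ps. block_pair p \<and> pair_supp p \<subseteq> {N<..}) \<and>
     sorted_wrt (\<lambda>p q. \<forall>i\<in>pair_supp p. \<forall>j\<in>pair_supp q. i < j) ps"

definition lincomb :: "(nat \<Rightarrow> real) \<Rightarrow> 'a list \<Rightarrow> 'a" where
  "lincomb a xs = (\<Sum>i<length xs. a i *\<^sub>R xs ! i)"

lemma finite_pair_supp: "block_pair p \<Longrightarrow> finite (pair_supp p)"
  by (auto simp: block_pair_def pair_supp_def fin_supp_unit_def)

text \<open>
  If this failed, then for every \<open>k\<close> and beyond every index there would be a finite sequence of pairs violating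
  the constant \<open>(k + 1)\<^sup>2\<close>. Concatenate such sequences and give the pairs of stage \<open>k\<close> the weight
  \<open>l = 1 / (k + 1)\<close>: the weighted domination just proved improves the constant of stage \<open>k\<close> to a fixed multiple
  of \<open>k + 1\<close>, which is a contradiction for large \<open>k\<close>.
\<close>

lemma uniform_domination:
  assumes compl: "\<And>Y. block_subspace e Y \<Longrightarrow> complemented Y"
  shows "\<exists>C N. \<forall>ps a. successive_pairs N ps \<longrightarrow>
           norm (lincomb a (map snd ps)) \<le> C * norm (lincomb a (map fst ps))"
proof (rule ccontr)
  assume neg: "\<not> ?thesis"
  let ?R = "\<lambda>p q. \<forall>i\<in>pair_supp p. \<forall>j\<in>pair_supp q. i < j"
  define bad where "bad k ps a \<longleftrightarrow>
    norm (lincomb a (map snd ps)) > (real k + 1)^2 * norm (lincomb a (map fst ps))" for k ps a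
  have ex_bad: "\<exists>ps a. successive_pairs N ps \<and> bad k ps a" for k N
  proof -
    from neg have "\<forall>C N. \<exists>ps a. successive_pairs N ps \<and>
        \<not> norm (lincomb a (map snd ps)) \<le> C * norm (lincomb a (map fst ps))"
      by blast
    then show ?thesis unfolding bad_def not_le by blast
  qed
  define good :: "(('a \<times> 'a) \<times> real) list \<Rightarrow> bool" where
    "good M \<longleftrightarrow> (\<forall>x\<in>set M. block_pair (fst x) \<and> 0 < snd x) \<and> sorted_wrt ?R (map fst M)" for M
  define step where "step k M M' \<longleftrightarrow>
    (\<exists>ps a. bad k ps a \<and> M' = M @ map (\<lambda>p. (p, 1 / (real k + 1))) ps)" for k and M M' :: "(('a \<times> 'a) \<times> real) list"
  \<comment> \<open>\<open>L k\<close> lists the pairs and weights of the stages before \<open>k\<close>; each list extends its predecessor.\<close>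
  have "\<exists>L. \<forall>k. good (L k) \<and> step k (L k) (L (Suc k))"
  proof (rule dependent_nat_choice)
    show "\<exists>M. good M" by (rule exI[of _ "[]"]) (simp add: good_def)
    fix M k assume M: "good M"
    let ?U = "\<Union>x\<in>set M. pair_supp (fst x)"
    have fU: "finite ?U" using M by (auto simp: good_def intro: finite_pair_supp)
    obtain N where N: "\<And>i. i \<in> ?U \<Longrightarrow> i \<le> N"
      using fU by (meson Max_ge)
    from ex_bad[of N k] obtain ps a where ps: "successive_pairs N ps" "bad k ps a" by blast
    let ?M' = "M @ map (\<lambda>p. (p, 1 / (real k + 1))) ps"
    have "good ?M'"
    proof -
      have "?R (fst x) p" if "x \<in> set M" "p \<in> set ps" for x p
      proof -
        have "\<forall>i\<in>pair_supp (fst x). i \<le> N" using N that(1) by blast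
        moreover have "pair_supp p \<subseteq> {N<..}" using ps(1) that(2) by (auto simp: successive_pairs_def)
        ultimately show ?thesis by fastforce
      qed
      then show ?thesis
        using M ps(1) by (auto simp: good_def successive_pairs_def sorted_wrt_append comp_def)
    qed
    then show "\<exists>M'. good M' \<and> step k M M'" using ps(2) unfolding step_def by blast
  qed
  then obtain L where L: "\<And>k. good (L k)" "\<And>k. step k (L k) (L (Suc k))" by blast
  have ext: "\<exists>ps a. bad k ps a \<and> L (Suc k) = L k @ map (\<lambda>p. (p, 1 / (real k + 1))) ps" for k
    using L(2)[of k] by (simp add: step_def)
  have len: "length (L k) < length (L (Suc k))" for k
  proof -
    from ext[of k] obtain ps a where ps: "bad k ps a" "L (Suc k) = L k @ map (\<lambda>p. (p, 1 / (real k + 1))) ps"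
      by blast
    then have "ps \<noteq> []" by (auto simp: bad_def lincomb_def)
    then show ?thesis using ps by simp
  qed
  have mono_len: "strict_mono (\<lambda>k. length (L k))"
    using len by (simp add: strict_mono_Suc_iff)
  have le_len: "k \<le> length (L k)" for k
    using strict_mono_imp_increasing[OF mono_len] by simp
  have pre: "L m ! i = L k ! i" if "k \<le> m" "i < length (L k)" for k m i
    using that(1)
  proof (induction m rule: dec_induct)
    case (step n)
    then have "length (L k) \<le> length (L n)"
      using strict_mono_less_eq[OF mono_len, of k n] by simp
    then show ?case using ext[of n] step.IH that(2) by (auto simp: nth_append)
  qed simp
  \<comment> \<open>Every stage is nonempty, so \<open>L (Suc i)\<close> is long enough to contain the \<open>i\<close>-th entry of the limit.\<close>
  define sq where "sq i = L (Suc i) ! i" for i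
  have sq: "sq i = L m ! i" if "i < length (L m)" for i m
  proof (cases "Suc i \<le> m")
    case True
    then show ?thesis using pre[OF True, of i] le_len[of "Suc i"] by (simp add: sq_def)
  next
    case False
    then show ?thesis using pre[of m "Suc i" i] that by (simp add: sq_def)
  qed
  have in_len: "i < length (L m)" if "i < m" for i m using le_len[of m] that by simp
  have sq_good: "block_pair (fst (sq i))" "0 < snd (sq i)" for i
    using L(1)[of "Suc i"] nth_mem[OF in_len[of i "Suc i"]] by (auto simp: good_def sq_def)
  have sq_sorted: "?R (fst (sq i)) (fst (sq j))" if "i < j" for i j
  proof -
    have ij: "i < length (L (Suc j))" "j < length (L (Suc j))" using that in_len by auto
    have "sorted_wrt ?R (map fst (L (Suc j)))" using L(1) by (simp add: good_def)
    from sorted_wrt_nth_less[OF this, of i j] show ?thesis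
      using that ij sq[OF ij(1)] sq[OF ij(2)] by simp
  qed
  have small: "snd (L m ! i) \<le> 1 / (real k + 1)" if "k \<le> m" "length (L k) \<le> i" "i < length (L m)" for k m i
    using that
  proof (induction m rule: dec_induct)
    case (step n)
    from ext[of n] obtain ps a where ps: "L (Suc n) = L n @ map (\<lambda>p. (p, 1 / (real n + 1))) ps" by blast
    show ?case
    proof (cases "i < length (L n)")
      case True
      then show ?thesis using step ps by (simp add: nth_append)
    next
      case False
      then have "snd (L (Suc n) ! i) = 1 / (real n + 1)" using ps step.prems by (simp add: nth_append)
      also have "\<dots> \<le> 1 / (real k + 1)" using step.hyps by (simp add: frac_le)
      finally show ?thesis .
    qed
  qed simp
  have lim: "(\<lambda>i. snd (sq i)) \<longlonglongrightarrow> 0"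
  proof (rule LIMSEQ_I)
    fix r :: real assume "0 < r"
    then obtain k where k: "1 / (real k + 1) < r"
      using reals_Archimedean[of r] by (auto simp: inverse_eq_divide add.commute)
    have "norm (snd (sq i) - 0) < r" if i: "i \<ge> length (L k)" for i
    proof -
      have "snd (sq i) \<le> 1 / (real k + 1)"
        unfolding sq_def
      proof (rule small)
        show "k \<le> Suc i" using le_len[of k] i by simp
      qed (use i in_len in auto)
      then show ?thesis using k sq_good(2)[of i] by simp
    qed
    then show "\<exists>no. \<forall>n\<ge>no. norm (snd (sq n) - 0) < r" by blast
  qed
  have "\<exists>C N. \<forall>F a. finite F \<and> F \<subseteq> {N..} \<longrightarrow>
      norm (\<Sum>i\<in>F. (a i * snd (sq i)) *\<^sub>R snd (fst (sq i))) \<le> C * norm (\<Sum>i\<in>F. a i *\<^sub>R fst (fst (sq i)))"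
  proof (rule complemented_domination[OF compl])
    show "p < q" if "i < j" "p \<in> supp e (fst (fst (sq i))) \<union> supp e (snd (fst (sq i)))"
      "q \<in> supp e (fst (fst (sq j))) \<union> supp e (snd (fst (sq j)))" for i j p q
      using sq_sorted[OF that(1)] that(2,3) unfolding pair_supp_def by blast
  qed (use sq_good lim in \<open>auto simp: block_pair_def\<close>)
  then obtain C N where CN: "\<forall>F a. finite F \<and> F \<subseteq> {N..} \<longrightarrow>
      norm (\<Sum>i\<in>F. (a i * snd (sq i)) *\<^sub>R snd (fst (sq i))) \<le> C * norm (\<Sum>i\<in>F. a i *\<^sub>R fst (fst (sq i)))"
    by (elim exE)
  obtain k0 :: nat where k0: "C \<le> real k0" using real_arch_simple by blast
  \<comment> \<open>A stage past the threshold \<open>N\<close> whose target constant exceeds what domination allows.\<close>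
  define k where "k = max N k0"
  from ext[of k] obtain ps a where ps: "bad k ps a" "L (Suc k) = L k @ map (\<lambda>p. (p, 1 / (real k + 1))) ps"
    by blast
  let ?n = "length (L k)"
  let ?F = "{0 + ?n ..< length ps + ?n}"
  have sqj: "sq (j + ?n) = (ps ! j, 1 / (real k + 1))" if "j < length ps" for j
    using sq[of "j + ?n" "Suc k"] ps(2) that by (simp add: nth_append)
  have F: "?F \<subseteq> {N..}" using le_len[of k] by (auto simp: k_def)
  have "(\<Sum>i\<in>?F. (a (i - ?n) * snd (sq i)) *\<^sub>R snd (fst (sq i))) = (1 / (real k + 1)) *\<^sub>R lincomb a (map snd ps)"
    unfolding sum.shift_bounds_nat_ivl lincomb_def scaleR_sum_right
    by (rule sum.cong) (auto simp: sqj)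
  moreover have "(\<Sum>i\<in>?F. a (i - ?n) *\<^sub>R fst (fst (sq i))) = lincomb a (map fst ps)"
    unfolding sum.shift_bounds_nat_ivl lincomb_def by (rule sum.cong) (auto simp: sqj)
  ultimately have "norm (lincomb a (map snd ps)) / (real k + 1) \<le> C * norm (lincomb a (map fst ps))"
    using CN[rule_format, OF conjI[OF finite_atLeastLessThan F], of "\<lambda>i. a (i - ?n)"] by simp
  also have "\<dots> \<le> (real k + 1) * norm (lincomb a (map fst ps))"
    by (intro mult_right_mono) (use k0 in \<open>auto simp: k_def\<close>)
  finally have "norm (lincomb a (map snd ps)) \<le> (real k + 1) * norm (lincomb a (map fst ps)) * (real k + 1)"
    by (subst (asm) pos_divide_le_eq) auto
  then have "norm (lincomb a (map snd ps)) \<le> (real k + 1)^2 * norm (lincomb a (map fst ps))"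
    by (simp only: power2_eq_square mult.assoc mult.commute mult.left_commute)
  then show False using ps(1) by (simp add: bad_def)
qed

section \<open>The asymptotic game\<close>

text \<open>
  Player I has a winning strategy for \<open>W\<close>, written as alternating quantifiers. Player II is not required to
  play successive vectors, but Player I can enforce it by large enough integers (lemma
  \<open>wins_successive\<close>).
\<close>

primrec wins :: "nat \<Rightarrow> ('a list \<Rightarrow> bool) \<Rightarrow> bool" where
  "wins 0 W \<longleftrightarrow> W []"
| "wins (Suc n) W \<longleftrightarrow> (\<exists>k::nat. \<forall>x. fin_supp_unit e x \<and> supp e x \<subseteq> {k<..} \<longrightarrow> wins n (\<lambda>xs. W (x # xs)))"

definition successive :: "nat \<Rightarrow> 'a list \<Rightarrow> bool" where
  "successive N xs \<longleftrightarrow> (\<forall>x\<in>set xs. fin_supp_unit e x \<and> supp e x \<subseteq> {N<..}) \<and>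
     sorted_wrt (\<lambda>x y. \<forall>i\<in>supp e x. \<forall>j\<in>supp e y. i < j) xs"

lemma wins_mono:
  assumes "wins n W" "\<And>xs. length xs = n \<Longrightarrow> W xs \<Longrightarrow> W' xs"
  shows "wins n W'"
  using assms
proof (induction n arbitrary: W W')
  case (Suc n)
  from Suc.prems(1) obtain k where
    k: "\<And>x. fin_supp_unit e x \<and> supp e x \<subseteq> {k<..} \<Longrightarrow> wins n (\<lambda>xs. W (x # xs))" by auto
  have "wins n (\<lambda>xs. W' (x # xs))" if "fin_supp_unit e x \<and> supp e x \<subseteq> {k<..}" for x
    by (rule Suc.IH[OF k[OF that]]) (use Suc.prems(2) in simp)
  then show ?case by auto
qed simp

lemma wins_True: "wins n (\<lambda>_. True)"
  by (induction n) auto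

lemma wins_const: "P \<Longrightarrow> wins n (\<lambda>_. P)"
  by (simp add: wins_True)

lemma wins_conj:
  assumes "wins n W" "wins n W'"
  shows "wins n (\<lambda>xs. W xs \<and> W' xs)"
  using assms
proof (induction n arbitrary: W W')
  case (Suc n)
  from Suc.prems obtain k k' where
    k: "\<And>x. fin_supp_unit e x \<and> supp e x \<subseteq> {k<..} \<Longrightarrow> wins n (\<lambda>xs. W (x # xs))" and
    k': "\<And>x. fin_supp_unit e x \<and> supp e x \<subseteq> {k'<..} \<Longrightarrow> wins n (\<lambda>xs. W' (x # xs))" by auto
  have "wins n (\<lambda>xs. W (x # xs) \<and> W' (x # xs))"
    if "fin_supp_unit e x \<and> supp e x \<subseteq> {max k k'<..}" for x
    by (rule Suc.IH[OF k k']) (use that in fastforce)+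
  then show ?case unfolding wins.simps by blast
qed simp

lemma wins_ball:
  assumes "finite A" "\<And>a. a \<in> A \<Longrightarrow> wins n (W a)"
  shows "wins n (\<lambda>xs. \<forall>a\<in>A. W a xs)"
  using assms
proof (induction A rule: finite_induct)
  case (insert a A)
  then have "wins n (\<lambda>xs. W a xs \<and> (\<forall>a\<in>A. W a xs))" by (intro wins_conj) auto
  then show ?case by simp
qed (simp add: wins_True)

lemma wins_add: "wins (k + m) W \<longleftrightarrow> wins k (\<lambda>xs. wins m (\<lambda>ys. W (xs @ ys)))"
  by (induction k arbitrary: W) auto

lemma successive_Cons:
  "successive N (x # xs) \<longleftrightarrow> fin_supp_unit e x \<and> supp e x \<subseteq> {N<..} \<and> successive N xs \<and>
     (\<forall>y\<in>set xs. \<forall>i\<in>supp e x. \<forall>j\<in>supp e y. i < j)"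
  by (auto simp: successive_def)

lemma successive_mono: "successive N xs \<Longrightarrow> M \<le> N \<Longrightarrow> successive M xs"
  by (fastforce simp: successive_def)

lemma fin_supp_bound:
  assumes "fin_supp_unit e x"
  obtains M where "N \<le> M" "\<And>i. i \<in> supp e x \<Longrightarrow> i \<le> M"
proof
  show "i \<le> max N (Max (supp e x))" if "i \<in> supp e x" for i
    using assms that Max_ge[of "supp e x" i] by (auto simp: fin_supp_unit_def le_max_iff_disj)
qed simp

lemma wins_successive: "wins n (successive N)"
proof (induction n arbitrary: N)
  case (Suc n)
  have "wins n (\<lambda>xs. successive N (x # xs))" if x: "fin_supp_unit e x \<and> supp e x \<subseteq> {N<..}" for x
  proof -
    obtain M where M: "N \<le> M" "\<And>i. i \<in> supp e x \<Longrightarrow> i \<le> M"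
      using fin_supp_bound x by blast
    have "successive N (x # xs)" if "successive M xs" for xs
    proof -
      have "i < j" if "y \<in> set xs" "i \<in> supp e x" "j \<in> supp e y" for y i j
      proof -
        have "j \<in> {M<..}" using \<open>successive M xs\<close> that unfolding successive_def by blast
        then show ?thesis using M(2)[OF that(2)] by simp
      qed
      then show ?thesis using x successive_mono[OF that M(1)] by (simp add: successive_Cons)
    qed
    then show ?thesis by (rule wins_mono[OF Suc.IH[of M]])
  qed
  then show ?case unfolding wins.simps by blast
qed (simp add: successive_def)

lemma exists_far: "\<exists>x. fin_supp_unit e x \<and> supp e x \<subseteq> {k<..}"
proof -
  let ?x = "(1 / norm (e (Suc k))) *\<^sub>R e (Suc k)"
  have n0: "e (Suc k) \<noteq> 0" by (rule basis_vector_nonzero[OF basis])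
  have "supp e (\<Sum>i\<in>{Suc k}. (1 / norm (e (Suc k))) *\<^sub>R e i) \<subseteq> {Suc k}"
    unfolding supp_def using coords_finite_sum[OF basis, of "{Suc k}" "\<lambda>_. 1 / norm (e (Suc k))"]
    by (auto split: if_splits)
  then have "supp e ?x \<subseteq> {Suc k}" by simp
  then have "finite (supp e ?x)" "supp e ?x \<subseteq> {k<..}" by (auto intro: finite_subset)
  then show ?thesis using n0 unfolding fin_supp_unit_def by (intro exI[of _ ?x]) auto
qed

text \<open>
  Player II always has a legal move, so a condition that Player I can enforce has an instance. Combined
  with \<open>wins_conj\<close> this compares finitely many enforceable conditions on a common outcome.
\<close>

lemma wins_play:
  assumes "wins n W"
  shows "\<exists>xs. length xs = n \<and> W xs"
  using assms
proof (induction n arbitrary: W)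
  case (Suc n)
  then obtain x where "wins n (\<lambda>xs. W (x # xs))" using exists_far unfolding wins.simps by blast
  from Suc.IH[OF this] obtain xs where "length xs = n" "W (x # xs)" by blast
  then show ?case by (intro exI[of _ "x # xs"]) simp
qed simp

text \<open>
  Player II follows one strategy for \<open>S\<close> and another for \<open>T\<close>. The two games are played in turn, and in each of
  them the moves of Player I are chosen larger than everything played so far in both.
\<close>

lemma wins_interlace:
  assumes "\<not> wins n (\<lambda>xs. \<not> S xs)" "\<not> wins n (\<lambda>xs. \<not> T xs)"
  shows "\<exists>ps. length ps = n \<and> successive_pairs N ps \<and> S (map fst ps) \<and> T (map snd ps)"
  using assms
proof (induction n arbitrary: S T N)
  case (Suc n)
  from Suc.prems(1) obtain x where x: "fin_supp_unit e x" "supp e x \<subseteq> {N<..}"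
    "\<not> wins n (\<lambda>xs. \<not> S (x # xs))" by auto
  obtain M where M: "N \<le> M" "\<And>i. i \<in> supp e x \<Longrightarrow> i \<le> M"
    using fin_supp_bound x(1) by blast
  from Suc.prems(2) obtain y where y: "fin_supp_unit e y" "supp e y \<subseteq> {M<..}"
    "\<not> wins n (\<lambda>xs. \<not> T (y # xs))" by auto
  obtain M' where M': "M \<le> M'" "\<And>i. i \<in> supp e y \<Longrightarrow> i \<le> M'"
    using fin_supp_bound y(1) by blast
  from Suc.IH[OF x(3) y(3), of M'] obtain ps where
    ps: "length ps = n" "successive_pairs M' ps" "S (x # map fst ps)" "T (y # map snd ps)" by blast
  have "supp e x \<inter> supp e y = {}" using M(2) y(2) by fastforce
  then have bp: "block_pair (x, y)" using x y by (simp add: block_pair_def)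
  have b1: "pair_supp (x, y) \<subseteq> {N<..}"
  proof -
    have "supp e y \<subseteq> {N<..}" using y(2) M(1) by fastforce
    then show ?thesis using x(2) by (simp add: pair_supp_def)
  qed
  have b2: "i \<le> M'" if "i \<in> pair_supp (x, y)" for i
    using that M M' unfolding pair_supp_def by fastforce
  have "successive_pairs N ((x, y) # ps)"
    using ps(2) bp b1 b2 M(1) M'(1) unfolding successive_pairs_def by fastforce
  then show ?case using ps by (intro exI[of _ "(x, y) # ps"]) simp
qed (simp add: successive_pairs_def)

lemma legal_play_Cons:
  assumes "legal_play e \<sigma> (x # xs)"
  shows "fin_supp_unit e x" "\<sigma> [] < int (Min (supp e x))" "legal_play e (\<lambda>ys. \<sigma> (x # ys)) xs"
  using assms unfolding legal_play_def
  by (fastforce dest: spec[where x=0] spec[where x="Suc k" for k])+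

text \<open>
  The integer of Player I in the quantifier form may depend on the past; choosing it for each past yields
  the strategy as a function.
\<close>

lemma wins_imp_player_I_wins:
  assumes "wins n W"
  shows "player_I_wins e n W"
  using assms
proof (induction n arbitrary: W)
  case 0
  then show ?case by (simp add: player_I_wins_def)
next
  case (Suc n)
  from Suc.prems obtain k where
    k: "\<And>x. fin_supp_unit e x \<and> supp e x \<subseteq> {k<..} \<Longrightarrow> wins n (\<lambda>xs. W (x # xs))" by auto
  have "\<exists>\<sigma>. fin_supp_unit e x \<and> supp e x \<subseteq> {k<..} \<longrightarrow>
     (\<forall>xs. length xs = n \<and> legal_play e \<sigma> xs \<longrightarrow> W (x # xs))" for x
    using Suc.IH[OF k, of x] unfolding player_I_wins_def by blast
  then obtain \<sigma> where \<sigma>: "\<And>x xs. fin_supp_unit e x \<Longrightarrow> supp e x \<subseteq> {k<..} \<Longrightarrow>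
     length xs = n \<Longrightarrow> legal_play e (\<sigma> x) xs \<Longrightarrow> W (x # xs)" by metis
  define \<tau> where "\<tau> ys = (case ys of [] \<Rightarrow> int k | x # xs \<Rightarrow> \<sigma> x xs)" for ys
  have "W ys" if ys: "length ys = Suc n" "legal_play e \<tau> ys" for ys
  proof -
    obtain x xs where yx: "ys = x # xs" "length xs = n" using ys(1) by (auto simp: length_Suc_conv)
    note lp = legal_play_Cons[OF ys(2)[unfolded yx(1)]]
    have "k < Min (supp e x)" using lp(2) by (simp add: \<tau>_def)
    moreover have "Min (supp e x) \<le> i" if "i \<in> supp e x" for i
      using that lp(1) by (simp add: fin_supp_unit_def)
    ultimately have "supp e x \<subseteq> {k<..}" by fastforce
    then show ?thesis using \<sigma>[of x xs] lp yx by (simp add: \<tau>_def)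
  qed
  then show ?case unfolding player_I_wins_def by blast
qed

lemma successive_distinct_supp:
  assumes "successive N xs"
  shows "i < length xs \<Longrightarrow> fin_supp_unit e (xs ! i)"
    and "i < length xs \<Longrightarrow> j < length xs \<Longrightarrow> i \<noteq> j \<Longrightarrow> supp e (xs ! i) \<inter> supp e (xs ! j) = {}"
proof -
  show "i < length xs \<Longrightarrow> fin_supp_unit e (xs ! i)" using assms by (simp add: successive_def)
  have lt: "p < q" if "i < j" "j < length xs" "p \<in> supp e (xs ! i)" "q \<in> supp e (xs ! j)" for i j p q
    using assms sorted_wrt_nth_less[of _ xs i j] that by (auto simp: successive_def)
  show "supp e (xs ! i) \<inter> supp e (xs ! j) = {}" if "i < length xs" "j < length xs" "i \<noteq> j"
    using lt[of i j] lt[of j i] that by (metis disjoint_iff less_irrefl linorder_neqE_nat)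
qed

lemma lincomb_mono:
  assumes xs: "successive N xs" and ba: "\<And>i. i < length xs \<Longrightarrow> \<bar>b i\<bar> \<le> \<bar>a i\<bar>"
  shows "norm (lincomb b xs) \<le> 2 * K * norm (lincomb a xs)"
  unfolding lincomb_def
  by (rule norm_sum_mono) (use successive_distinct_supp[OF xs] ba in \<open>auto simp: fin_supp_unit_def\<close>)

lemma lincomb_coefficient:
  assumes xs: "successive N xs" and i: "i < length xs"
  shows "\<bar>a i\<bar> \<le> K * norm (lincomb a xs)"
proof -
  have "\<bar>a i\<bar> * norm (xs ! i) \<le> K * norm (lincomb a xs)"
    unfolding lincomb_def
    by (rule coefficient_le) (use successive_distinct_supp[OF xs] i in \<open>auto simp: fin_supp_unit_def\<close>)
  then show ?thesis using successive_distinct_supp(1)[OF xs i] by (simp add: fin_supp_unit_def)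
qed

lemma norm_lincomb_le:
  assumes xs: "successive N xs"
  shows "norm (lincomb a xs) \<le> (\<Sum>i<length xs. \<bar>a i\<bar>)"
  unfolding lincomb_def
  by (rule sum_norm_le) (use successive_distinct_supp(1)[OF xs] in \<open>simp add: fin_supp_unit_def\<close>)

lemma lincomb_Cons: "lincomb a (x # xs) = a 0 *\<^sub>R x + lincomb (\<lambda>i. a (Suc i)) xs"
  by (simp add: lincomb_def sum.lessThan_Suc_shift del: sum.lessThan_Suc)

lemma lincomb_diff: "lincomb a xs - lincomb b xs = lincomb (\<lambda>i. a i - b i) xs"
  by (simp add: lincomb_def sum_subtractf scaleR_left_diff_distrib)

lemma lincomb_scaleR: "lincomb (\<lambda>i. r * a i) xs = r *\<^sub>R lincomb a xs"
  by (simp add: lincomb_def scaleR_sum_right)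

text \<open>
  Take \<open>r\<close> almost maximal among the lower bounds that Player I can enforce. Then Player II can force the norm to
  be at most \<open>2 * r\<close>; if Player II could also force it above \<open>2 * C * r\<close>, interlacing the two strategies would
  contradict domination with constant \<open>C\<close>.
\<close>

lemma wins_stable_norm:
  assumes compl: "\<And>Y. block_subspace e Y \<Longrightarrow> complemented Y"
  shows "\<exists>D\<ge>1. \<forall>n a. (\<exists>i<n. a i \<noteq> 0) \<longrightarrow>
    (\<exists>r>0. wins n (\<lambda>xs. r \<le> norm (lincomb a xs) \<and> norm (lincomb a xs) \<le> D * r))"
proof -
  from uniform_domination[OF compl] obtain C0 N where
    C0: "\<And>ps a. successive_pairs N ps \<Longrightarrow>
           norm (lincomb a (map snd ps)) \<le> C0 * norm (lincomb a (map fst ps))" by blast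
  define C where "C = max 1 C0"
  have C: "norm (lincomb a (map snd ps)) \<le> C * norm (lincomb a (map fst ps))" if "successive_pairs N ps" for ps a
    using C0[OF that] by (rule order_trans) (simp add: C_def mult_right_mono)
  show ?thesis
  proof (rule exI[of _ "2 * C"], intro conjI allI impI)
    show "1 \<le> 2 * C" by (simp add: C_def)
    fix n and a :: "nat \<Rightarrow> real" assume "\<exists>i<n. a i \<noteq> 0"
    then obtain i where i: "i < n" "a i \<noteq> 0" by blast
    define A where "A = {r. 0 < r \<and> wins n (\<lambda>xs. r < norm (lincomb a xs))}"
    have "\<bar>a i\<bar> / (2 * K) \<in> A"
    proof -
      have "wins n (\<lambda>xs. \<bar>a i\<bar> / (2 * K) < norm (lincomb a xs))"
      proof (rule wins_mono[OF wins_successive[of n 0]])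
        fix xs :: "'a list" assume xs: "length xs = n" "successive 0 xs"
        have "\<bar>a i\<bar> \<le> K * norm (lincomb a xs)" by (rule lincomb_coefficient[OF xs(2)]) (use xs i in simp)
        moreover have "0 < \<bar>a i\<bar>" using i by simp
        ultimately have "\<bar>a i\<bar> < (2 * K) * norm (lincomb a xs)" by linarith
        then show "\<bar>a i\<bar> / (2 * K) < norm (lincomb a xs)"
          using K_pos by (simp add: pos_divide_less_eq mult.commute)
      qed
      then show ?thesis using i K_pos by (simp add: A_def)
    qed
    then have ne: "A \<noteq> {}" by blast
    have bdd: "r \<le> (\<Sum>i<n. \<bar>a i\<bar>)" if "r \<in> A" for r
    proof -
      from that have "wins n (\<lambda>xs. r < norm (lincomb a xs) \<and> successive 0 xs)"
        by (intro wins_conj wins_successive) (simp add: A_def)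
      from wins_play[OF this] obtain xs where
        "length xs = n" "r < norm (lincomb a xs)" "successive 0 xs" by blast
      then show ?thesis using norm_lincomb_le[of 0 xs a] by simp
    qed
    then have bA: "bdd_above A" by (auto simp: bdd_above_def)
    have "0 < Sup A" using cSup_upper[OF _ bA] ne by (fastforce simp: A_def)
    then obtain r where r: "r \<in> A" "Sup A / 2 < r"
      using less_cSupE[of "Sup A / 2" A] ne by auto
    then have "2 * r \<notin> A" using cSup_upper[OF _ bA, of "2 * r"] by auto
    with r(1) have nw: "\<not> wins n (\<lambda>xs. \<not> norm (lincomb a xs) \<le> 2 * r)" by (simp add: A_def not_le)
    have "wins n (\<lambda>xs. norm (lincomb a xs) \<le> 2 * C * r)"
    proof (rule ccontr)
      assume "\<not> ?thesis"
      then have "\<not> wins n (\<lambda>xs. \<not> 2 * C * r < norm (lincomb a xs))" by (simp add: not_less)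
      from wins_interlace[OF nw this, of N] obtain ps where
        ps: "length ps = n" "successive_pairs N ps" "norm (lincomb a (map fst ps)) \<le> 2 * r"
          "2 * C * r < norm (lincomb a (map snd ps))" by blast
      have "C * norm (lincomb a (map fst ps)) \<le> C * (2 * r)"
        using ps(3) by (intro mult_left_mono) (auto simp: C_def)
      then show False using C[OF ps(2), of a] ps(4) by simp
    qed
    moreover have "wins n (\<lambda>xs. r < norm (lincomb a xs))" using r(1) by (simp add: A_def)
    ultimately have "wins n (\<lambda>xs. r < norm (lincomb a xs) \<and> norm (lincomb a xs) \<le> 2 * C * r)"
      by (intro wins_conj)
    then have "wins n (\<lambda>xs. r \<le> norm (lincomb a xs) \<and> norm (lincomb a xs) \<le> 2 * C * r)"
      by (rule wins_mono) auto
    then show "\<exists>r>0. wins n (\<lambda>xs. r \<le> norm (lincomb a xs) \<and> norm (lincomb a xs) \<le> 2 * C * r)"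
      using r(1) by (auto simp: A_def)
  qed
qed

section \<open>The norm of a sum of glued moves\<close>

abbreviation block_total :: "'a list \<Rightarrow> 'a" where
  "block_total \<equiv> lincomb (\<lambda>_. 1)"

definition normalize_total :: "'a list \<Rightarrow> 'a" where
  "normalize_total xs = (1 / norm (block_total xs)) *\<^sub>R block_total xs"

text \<open>
  The normalised sum of consecutive moves is again a legal move; unconditionality prevents the sum from vanishing.
\<close>

lemma normalize_total_block:
  assumes "successive N xs" "xs \<noteq> []"
  shows "fin_supp_unit e (normalize_total xs)" "supp e (normalize_total xs) \<subseteq> {N<..}"
    "block_total xs = norm (block_total xs) *\<^sub>R normalize_total xs"
proof -
  have "(1::real) \<le> K * norm (block_total xs)"
    using lincomb_coefficient[OF assms(1), of 0 "\<lambda>_. 1"] assms(2) by simp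
  then have nz: "block_total xs \<noteq> 0" by auto
  let ?U = "\<Union>i<length xs. supp e (xs ! i)"
  have "supp e (block_total xs) \<subseteq> ?U"
    unfolding lincomb_def scaleR_one by (rule supp_sum_subset)
  then have sub: "supp e (normalize_total xs) \<subseteq> ?U"
    unfolding normalize_total_def using supp_scaleR_subset by blast
  have "finite ?U" using successive_distinct_supp(1)[OF assms(1)] by (auto simp: fin_supp_unit_def)
  then have "finite (supp e (normalize_total xs))" using sub finite_subset by blast
  then show "fin_supp_unit e (normalize_total xs)"
    using nz by (simp add: fin_supp_unit_def normalize_total_def)
  have "?U \<subseteq> {N<..}" using assms(1) by (auto simp: successive_def)
  then show "supp e (normalize_total xs) \<subseteq> {N<..}" using sub by blast
  show "block_total xs = norm (block_total xs) *\<^sub>R normalize_total xs"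
    using nz by (simp add: normalize_total_def)
qed

lemma lincomb_append:
  "lincomb a (xs @ ys) = lincomb a xs + lincomb (\<lambda>i. a (length xs + i)) ys"
proof (induction xs arbitrary: a)
  case (Cons x xs)
  then show ?case by (simp add: lincomb_Cons add.assoc)
qed (simp add: lincomb_def)

text \<open>
  Player I simulates a game of length \<open>n\<close> inside a longer one: during the \<open>i\<close>-th group of \<open>k i\<close> moves
  Player I keeps all vectors beyond the integer demanded by the short game, whose \<open>i\<close>-th move is the normalised sum of
  the group, and meanwhile also enforces \<open>Q i\<close> on the norm of that sum.
\<close>

lemma wins_blocking:
  assumes "wins n W"
    and "\<And>i. i < n \<Longrightarrow> 1 \<le> k i \<and> wins (k i) (\<lambda>xs. Q i (norm (block_total xs)))"
  shows "wins (\<Sum>i<n. k i) (\<lambda>xs. \<exists>ys s. length ys = n \<and> W ys \<and> (\<forall>i<n. Q i (s i)) \<and>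
           block_total xs = lincomb s ys)"
  using assms
proof (induction n arbitrary: W k Q)
  case 0
  then show ?case by (auto simp: lincomb_def)
next
  case (Suc n)
  let ?m = "\<Sum>i<n. k (Suc i)"
  let ?G = "\<lambda>xs. \<exists>ys s. length ys = Suc n \<and> W ys \<and> (\<forall>i<Suc n. Q i (s i)) \<and> block_total xs = lincomb s ys"
  from Suc.prems(1) obtain N where
    N: "\<And>x. fin_supp_unit e x \<Longrightarrow> supp e x \<subseteq> {N<..} \<Longrightarrow> wins n (\<lambda>ys. W (x # ys))" by auto
  have k0: "1 \<le> k 0" "wins (k 0) (\<lambda>xs. Q 0 (norm (block_total xs)))" using Suc.prems(2)[of 0] by auto
  have "wins (k 0) (\<lambda>xs. wins ?m (\<lambda>zs. ?G (xs @ zs)))"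
  proof (rule wins_mono[OF wins_conj[OF wins_successive[of _ N] k0(2)]])
    fix xs :: "'a list" assume len: "length xs = k 0" and xs: "successive N xs \<and> Q 0 (norm (block_total xs))"
    let ?y = "normalize_total xs"
    have ne: "xs \<noteq> []" using len k0 by auto
    note y = normalize_total_block[OF conjunct1[OF xs] ne]
    have "wins ?m (\<lambda>zs. \<exists>ys s. length ys = n \<and> W (?y # ys) \<and> (\<forall>i<n. Q (Suc i) (s i)) \<and>
        block_total zs = lincomb s ys)"
      by (rule Suc.IH[OF N[OF y(1,2)]]) (use Suc.prems(2) in auto)
    then show "wins ?m (\<lambda>zs. ?G (xs @ zs))"
    proof (rule wins_mono)
      fix zs :: "'a list"
      assume "\<exists>ys s. length ys = n \<and> W (?y # ys) \<and> (\<forall>i<n. Q (Suc i) (s i)) \<and> block_total zs = lincomb s ys"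
      then obtain ys s where ys: "length ys = n" "W (?y # ys)" "\<forall>i<n. Q (Suc i) (s i)" "block_total zs = lincomb s ys"
        by blast
      let ?s = "case_nat (norm (block_total xs)) s"
      have "block_total (xs @ zs) = lincomb ?s (?y # ys)"
        using y(3) ys(4) by (simp add: lincomb_append lincomb_Cons)
      moreover have "\<forall>i<Suc n. Q i (?s i)" using ys(3) xs by (auto split: nat.split)
      ultimately show "?G (xs @ zs)" using ys(1,2) by (intro exI[of _ "?y # ys"] exI[of _ ?s]) simp
    qed
  qed
  then have "wins (k 0 + ?m) ?G" by (simp only: wins_add)
  then show ?case by (simp only: sum.lessThan_Suc_shift)
qed

text \<open>
  Play one game of length \<open>\<Sum> k i\<close> in which Player I enforces three things at once: the norm of the total sum,
  the norms \<open>s i\<close> of the sums of the groups, and the norm of the combination of the normalised sums with the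
  coefficients \<open>lam (k i)\<close>. As \<open>s i\<close> is comparable to \<open>lam (k i)\<close>, unconditionality relates the first to the last.
\<close>

lemma block_estimate:
  assumes D: "1 \<le> D"
    and stable: "\<And>n a. \<exists>i<n. a i \<noteq> 0 \<Longrightarrow>
      \<exists>r>0. wins n (\<lambda>xs. r \<le> norm (lincomb a xs) \<and> norm (lincomb a xs) \<le> D * r)"
    and lam: "\<And>k. 1 \<le> k \<Longrightarrow> 0 < lam k"
      "\<And>k. 1 \<le> k \<Longrightarrow> wins k (\<lambda>xs. lam k \<le> norm (block_total xs) \<and> norm (block_total xs) \<le> D * lam k)"
    and n: "1 \<le> n" and k: "\<And>i. i < n \<Longrightarrow> 1 \<le> k i"
  shows "wins n (\<lambda>ys. lam (\<Sum>i<n. k i) \<le> 2 * K * D^2 * norm (lincomb (\<lambda>i. lam (k i)) ys) \<and>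
           norm (lincomb (\<lambda>i. lam (k i)) ys) \<le> 2 * K * D^2 * lam (\<Sum>i<n. k i))"
proof -
  let ?a = "\<lambda>i. lam (k i)" and ?M = "\<Sum>i<n. k i"
  have apos: "0 < ?a i" if "i < n" for i using lam(1) k that by simp
  have "\<exists>i<n. ?a i \<noteq> 0" using apos[of 0] n by (intro exI[of _ 0]) simp
  from stable[OF this] obtain r where
    r: "0 < r" "wins n (\<lambda>ys. r \<le> norm (lincomb ?a ys) \<and> norm (lincomb ?a ys) \<le> D * r)" by blast
  have "k 0 \<le> ?M" by (rule member_le_sum) (use n in auto)
  then have M1: "1 \<le> ?M" using k[of 0] n by simp
  have "wins ?M (\<lambda>xs. \<exists>ys s. length ys = n \<and> ((r \<le> norm (lincomb ?a ys) \<and> norm (lincomb ?a ys) \<le> D * r) \<and> successive 0 ys) \<and>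
      (\<forall>i<n. lam (k i) \<le> s i \<and> s i \<le> D * lam (k i)) \<and> block_total xs = lincomb s ys)"
    by (rule wins_blocking[OF wins_conj[OF r(2) wins_successive]]) (use k lam(2) in auto)
  from wins_play[OF wins_conj[OF this lam(2)[OF M1]]]
  obtain xs ys s where o: "length ys = n" "r \<le> norm (lincomb ?a ys)" "norm (lincomb ?a ys) \<le> D * r"
    "successive 0 ys" "\<And>i. i < n \<Longrightarrow> lam (k i) \<le> s i \<and> s i \<le> D * lam (k i)" "block_total xs = lincomb s ys"
    "lam ?M \<le> norm (block_total xs)" "norm (block_total xs) \<le> D * lam ?M" by blast
  have "lam ?M \<le> norm (lincomb s ys)" using o by simp
  also have "\<dots> \<le> 2 * K * norm (lincomb (\<lambda>i. D * ?a i) ys)"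
  proof (rule lincomb_mono[OF o(4)])
    fix i assume "i < length ys"
    then have i: "i < n" using o(1) by simp
    show "\<bar>s i\<bar> \<le> \<bar>D * ?a i\<bar>" using o(5)[OF i] apos[OF i] by linarith
  qed
  also have "\<dots> = 2 * K * (D * norm (lincomb ?a ys))" using D by (simp add: lincomb_scaleR)
  also have "\<dots> \<le> 2 * K * (D * (D * r))" using D K_pos o(3) by (intro mult_left_mono) auto
  finally have 1: "lam ?M \<le> 2 * K * D^2 * r" by (simp add: power2_eq_square mult.assoc)
  have "r \<le> norm (lincomb ?a ys)" by (rule o(2))
  also have "\<dots> \<le> 2 * K * norm (lincomb s ys)"
  proof (rule lincomb_mono[OF o(4)])
    fix i assume "i < length ys"
    then have i: "i < n" using o(1) by simp
    show "\<bar>?a i\<bar> \<le> \<bar>s i\<bar>" using o(5)[OF i] apos[OF i] by linarith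
  qed
  also have "\<dots> \<le> 2 * K * (D * lam ?M)" using o(6,8) K_pos by (intro mult_left_mono) auto
  finally have 2: "r \<le> 2 * K * (D * lam ?M)" .
  show ?thesis
  proof (rule wins_mono[OF r(2)])
    fix ys assume ys: "r \<le> norm (lincomb ?a ys) \<and> norm (lincomb ?a ys) \<le> D * r"
    have "2 * K * D^2 * r \<le> 2 * K * D^2 * norm (lincomb ?a ys)"
      using ys K_pos by (intro mult_left_mono) auto
    moreover have "D * r \<le> D * (2 * K * (D * lam ?M))" using 2 D by (intro mult_left_mono) auto
    ultimately show "lam ?M \<le> 2 * K * D^2 * norm (lincomb ?a ys) \<and>
        norm (lincomb ?a ys) \<le> 2 * K * D^2 * lam ?M"
      using 1 ys by (simp add: power2_eq_square mult_ac)
  qed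
qed

text \<open>
  The sequence \<open>lam\<close> is almost increasing by unconditionality and almost multiplicative by
  \<open>block_estimate\<close> for groups of equal length, so it is comparable to a power; substituting this power for \<open>lam\<close> in
  \<open>block_estimate\<close> gives the claim.
\<close>

lemma power_estimate:
  assumes compl: "\<And>Y. block_subspace e Y \<Longrightarrow> complemented Y"
  shows "\<exists>\<alpha> E. 0 \<le> \<alpha> \<and> \<alpha> \<le> 1 \<and> 1 \<le> E \<and> (\<forall>n k. 1 \<le> n \<and> (\<forall>i<n. 1 \<le> k i) \<longrightarrow>
    wins n (\<lambda>ys. real (\<Sum>i<n. k i) powr \<alpha> \<le> E * norm (lincomb (\<lambda>i. real (k i) powr \<alpha>) ys) \<and>
      norm (lincomb (\<lambda>i. real (k i) powr \<alpha>) ys) \<le> E * real (\<Sum>i<n. k i) powr \<alpha>))"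
proof -
  have "\<exists>D\<ge>1. \<forall>n a. (\<exists>i<n. a i \<noteq> 0) \<longrightarrow>
      (\<exists>r>0. wins n (\<lambda>xs. r \<le> norm (lincomb a xs) \<and> norm (lincomb a xs) \<le> D * r))"
    by (rule wins_stable_norm[OF compl])
  then obtain D where "1 \<le> D \<and> (\<forall>n a. (\<exists>i<n. a i \<noteq> 0) \<longrightarrow>
      (\<exists>r>0. wins n (\<lambda>xs. r \<le> norm (lincomb a xs) \<and> norm (lincomb a xs) \<le> D * r)))"
    by (elim exE)
  then have D: "1 \<le> D" and stable: "\<And>n a. \<exists>i<n. a i \<noteq> 0 \<Longrightarrow>
      \<exists>r>0. wins n (\<lambda>xs. r \<le> norm (lincomb a xs) \<and> norm (lincomb a xs) \<le> D * r)"
    by simp_all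
  define good where "good k r \<longleftrightarrow> 0 < r \<and> wins k (\<lambda>xs. r \<le> norm (block_total xs) \<and> norm (block_total xs) \<le> D * r)" for k r
  define lam where "lam k = (SOME r. good k r)" for k
  have "good k (lam k)" if "1 \<le> k" for k
  proof -
    have "\<exists>r. good k r"
      unfolding good_def by (rule stable) (use that in \<open>auto intro!: exI[of _ 0]\<close>)
    then show ?thesis unfolding lam_def by (rule someI_ex)
  qed
  then have lam: "\<And>k. 1 \<le> k \<Longrightarrow> 0 < lam k"
    "\<And>k. 1 \<le> k \<Longrightarrow> wins k (\<lambda>xs. lam k \<le> norm (block_total xs) \<and> norm (block_total xs) \<le> D * lam k)"
    by (simp_all add: good_def)
  have be: "wins n (\<lambda>ys. lam (\<Sum>i<n. k i) \<le> 2 * K * D^2 * norm (lincomb (\<lambda>i. lam (k i)) ys) \<and>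
           norm (lincomb (\<lambda>i. lam (k i)) ys) \<le> 2 * K * D^2 * lam (\<Sum>i<n. k i))"
    if "1 \<le> n" "\<And>i. i < n \<Longrightarrow> 1 \<le> k i" for n k
    by (rule block_estimate[OF D stable lam]) (use that in auto)
  define B where "B = 2 * K * D^2 * D"
  have KD: "1 \<le> K * D^2" using mult_mono[of 1 K 1 "D^2"] K_ge_1 D one_le_power[of D 2] by simp
  have leB: "2 * K * D^2 \<le> B" "1 \<le> B" "2 * K * D \<le> B"
  proof -
    have "2 * K * D^2 * 1 \<le> B" unfolding B_def using D K_pos by (intro mult_left_mono) auto
    then show 1: "2 * K * D^2 \<le> B" by simp
    then show "1 \<le> B" using KD by linarith
    have "2 * K * D * 1 \<le> 2 * K * D * D" using D K_pos by (intro mult_left_mono) auto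
    then show "2 * K * D \<le> B" using 1 by (simp add: power2_eq_square mult.assoc)
  qed
  \<comment> \<open>Compare a game of length \<open>n\<close> with its first \<open>m\<close> moves.\<close>
  have lmono: "lam m \<le> B * lam n" if "1 \<le> m" "m \<le> n" for m n
  proof -
    have "wins m (\<lambda>xs. wins (n - m) (\<lambda>ys. lam m \<le> norm (block_total xs)))"
      by (rule wins_mono[OF lam(2)[OF that(1)]]) (simp add: wins_const)
    moreover
    have "wins n (\<lambda>xs. norm (block_total xs) \<le> D * lam n)"
      by (rule wins_mono[OF lam(2)[of n]]) (use that in auto)
    then have "wins n (\<lambda>xs. successive 0 xs \<and> norm (block_total xs) \<le> D * lam n)"
      by (rule wins_conj[OF wins_successive])
    then have "wins (m + (n - m)) (\<lambda>xs. successive 0 xs \<and> norm (block_total xs) \<le> D * lam n)"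
      using that by simp
    then have "wins m (\<lambda>xs. wins (n - m) (\<lambda>ys. successive 0 (xs @ ys) \<and>
        norm (block_total (xs @ ys)) \<le> D * lam n))"
      by (simp only: wins_add)
    ultimately have "wins m (\<lambda>xs. wins (n - m) (\<lambda>ys. lam m \<le> norm (block_total xs)) \<and>
        wins (n - m) (\<lambda>ys. successive 0 (xs @ ys) \<and> norm (block_total (xs @ ys)) \<le> D * lam n))"
      by (rule wins_conj)
    from wins_play[OF this] obtain xs where xs: "length xs = m" "wins (n - m) (\<lambda>ys. lam m \<le> norm (block_total xs))"
      "wins (n - m) (\<lambda>ys. successive 0 (xs @ ys) \<and> norm (block_total (xs @ ys)) \<le> D * lam n)" by blast
    from wins_play[OF wins_conj[OF xs(2,3)]] obtain ys where ys: "lam m \<le> norm (block_total xs)"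
      "successive 0 (xs @ ys)" "norm (block_total (xs @ ys)) \<le> D * lam n" by blast
    have z: "lincomb (\<lambda>i. 0) ys = 0" by (simp add: lincomb_def)
    have "block_total xs = lincomb (\<lambda>i. if i < m then 1 else 0) xs"
      unfolding lincomb_def by (rule sum.cong) (auto simp: xs(1))
    then have "block_total xs = lincomb (\<lambda>i. if i < m then 1 else 0) (xs @ ys)"
      by (simp add: lincomb_append z xs(1))
    then have "norm (block_total xs) \<le> 2 * K * norm (block_total (xs @ ys))"
      using lincomb_mono[OF ys(2), of "\<lambda>i. if i < m then 1 else 0" "\<lambda>_. 1"] by simp
    also have "\<dots> \<le> 2 * K * (D * lam n)" using ys K_pos by (intro mult_left_mono) auto
    also have "\<dots> = (2 * K * D) * lam n" by simp
    also have "\<dots> \<le> B * lam n" using leB lam(1)[of n] that by (intro mult_right_mono) auto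
    finally show ?thesis using ys(1) by simp
  qed
  have lmult: "lam (m * n) \<le> B * (lam m * lam n) \<and> lam m * lam n \<le> B * lam (m * n)" if "1 \<le> m" "1 \<le> n" for m n
  proof -
    have "wins m (\<lambda>ys. lam (\<Sum>i<m. n) \<le> 2 * K * D^2 * norm (lincomb (\<lambda>i. lam n) ys) \<and>
           norm (lincomb (\<lambda>i. lam n) ys) \<le> 2 * K * D^2 * lam (\<Sum>i<m. n))"
      by (rule be) (use that in auto)
    from wins_play[OF wins_conj[OF this lam(2)[OF that(1)]]] obtain ys where
      ys: "lam (m * n) \<le> 2 * K * D^2 * norm (lincomb (\<lambda>i. lam n) ys)"
        "norm (lincomb (\<lambda>i. lam n) ys) \<le> 2 * K * D^2 * lam (m * n)"
        "lam m \<le> norm (block_total ys)" "norm (block_total ys) \<le> D * lam m" by auto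
    have pos: "0 < lam n" "0 < lam m" "0 < lam (m * n)" using lam(1) that by auto
    have eq: "norm (lincomb (\<lambda>i. lam n) ys) = lam n * norm (block_total ys)"
      using lincomb_scaleR[of "lam n" "\<lambda>_. 1" ys] pos by simp
    have "lam (m * n) \<le> 2 * K * D^2 * (lam n * (D * lam m))"
      using ys(1,4) pos K_pos unfolding eq by (smt (verit) mult_left_mono mult_pos_pos zero_le_power2 mult_nonneg_nonneg)
    moreover have "lam n * lam m \<le> 2 * K * D^2 * lam (m * n)"
      using ys(2) mult_left_mono[OF ys(3), of "lam n"] pos unfolding eq by linarith
    moreover have "2 * K * D^2 * lam (m * n) \<le> B * lam (m * n)"
      using leB(1) pos by (intro mult_right_mono) auto
    ultimately show ?thesis by (simp add: B_def mult_ac)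
  qed
  have lle: "lam n \<le> real n" if "1 \<le> n" for n
  proof -
    from wins_play[OF wins_conj[OF lam(2)[OF that] wins_successive[of n 0]]] obtain xs where
      xs: "length xs = n" "lam n \<le> norm (block_total xs)" "successive 0 xs" by blast
    then show ?thesis using norm_lincomb_le[OF xs(3), of "\<lambda>_. 1"] by simp
  qed
  have "\<exists>\<alpha>. 0 \<le> \<alpha> \<and> \<alpha> \<le> 1 \<and>
      (\<forall>n\<ge>1. real n powr \<alpha> \<le> B^2 * lam n \<and> lam n \<le> B^2 * real n powr \<alpha>)"
    by (rule almost_multiplicative_imp_power) (use leB lam(1) lmono lmult lle in auto)
  then obtain \<alpha> where \<alpha>: "0 \<le> \<alpha>" "\<alpha> \<le> 1"
    "\<And>n. 1 \<le> n \<Longrightarrow> real n powr \<alpha> \<le> B^2 * lam n" "\<And>n. 1 \<le> n \<Longrightarrow> lam n \<le> B^2 * real n powr \<alpha>" by blast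
  define A where "A = B^2"
  have A1: "1 \<le> A" using leB one_le_power[of B 2] by (simp add: A_def)
  define E where "E = A * (B * (2 * K * A))"
  have E1: "1 \<le> E"
  proof -
    have "1 * 1 \<le> (2 * K) * A" by (intro mult_mono) (use K_ge_1 A1 in auto)
    then have "1 * 1 \<le> B * (2 * K * A)" by (intro mult_mono) (use leB in auto)
    then have "1 * 1 \<le> E" unfolding E_def by (intro mult_mono) (use A1 in auto)
    then show ?thesis by simp
  qed
  have "wins n (\<lambda>ys. real (\<Sum>i<n. k i) powr \<alpha> \<le> E * norm (lincomb (\<lambda>i. real (k i) powr \<alpha>) ys) \<and>
      norm (lincomb (\<lambda>i. real (k i) powr \<alpha>) ys) \<le> E * real (\<Sum>i<n. k i) powr \<alpha>)"
    if n: "1 \<le> n" and k: "\<forall>i<n. 1 \<le> k i" for n k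
  proof -
    let ?M = "\<Sum>i<n. k i" and ?a = "\<lambda>i. lam (k i)" and ?c = "\<lambda>i. real (k i) powr \<alpha>"
    have "k 0 \<le> ?M" by (rule member_le_sum) (use n in auto)
    then have M1: "1 \<le> ?M" using k n by force
    have "wins n (\<lambda>ys. lam ?M \<le> 2 * K * D^2 * norm (lincomb ?a ys) \<and>
           norm (lincomb ?a ys) \<le> 2 * K * D^2 * lam ?M)"
      by (rule be[OF n]) (use k in auto)
    then show ?thesis
    proof (rule wins_mono[OF wins_conj[OF _ wins_successive[of n 0]]])
      fix ys :: "'a list"
      assume len: "length ys = n" and "(lam ?M \<le> 2 * K * D^2 * norm (lincomb ?a ys) \<and>
           norm (lincomb ?a ys) \<le> 2 * K * D^2 * lam ?M) \<and> successive 0 ys"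
      then have ys: "lam ?M \<le> 2 * K * D^2 * norm (lincomb ?a ys)"
        "norm (lincomb ?a ys) \<le> 2 * K * D^2 * lam ?M" "successive 0 ys" by auto
      have lM: "0 < lam ?M" using lam(1)[OF M1] .
      have up: "lam ?M \<le> B * norm (lincomb ?a ys)"
        using ys(1) mult_right_mono[OF leB(1), of "norm (lincomb ?a ys)"] by simp
      have low: "norm (lincomb ?a ys) \<le> B * lam ?M"
        using order_trans[OF ys(2) mult_right_mono[OF leB(1), of "lam ?M"]] lM by simp
      have ca: "norm (lincomb ?c ys) \<le> 2 * K * norm (lincomb (\<lambda>i. A * ?a i) ys)"
      proof (rule lincomb_mono[OF ys(3)])
        fix i assume "i < length ys"
        then have ki: "1 \<le> k i" using k len by simp
        show "\<bar>?c i\<bar> \<le> \<bar>A * ?a i\<bar>" using \<alpha>(3)[OF ki] by (simp add: A_def)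
      qed
      have ac: "norm (lincomb ?a ys) \<le> 2 * K * norm (lincomb (\<lambda>i. A * ?c i) ys)"
      proof (rule lincomb_mono[OF ys(3)])
        fix i assume "i < length ys"
        then have ki: "1 \<le> k i" using k len by simp
        show "\<bar>?a i\<bar> \<le> \<bar>A * ?c i\<bar>" using \<alpha>(4)[OF ki] lam(1)[OF ki] by (simp add: A_def)
      qed
      have A: "norm (lincomb (\<lambda>i. A * b i) ys) = A * norm (lincomb b ys)" for b
        using A1 by (simp add: lincomb_scaleR)
      have "real ?M powr \<alpha> \<le> A * lam ?M" using \<alpha>(3)[OF M1] by (simp only: A_def)
      also have "\<dots> \<le> A * (B * norm (lincomb ?a ys))" using up A1 by (intro mult_left_mono) auto
      also have "\<dots> \<le> A * (B * (2 * K * norm (lincomb (\<lambda>i. A * ?c i) ys)))"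
        using ac A1 leB by (intro mult_left_mono) auto
      also have "\<dots> = E * norm (lincomb ?c ys)" unfolding A E_def by (simp add: mult_ac)
      finally have *: "real ?M powr \<alpha> \<le> E * norm (lincomb ?c ys)" .
      have "norm (lincomb ?c ys) \<le> 2 * K * (A * norm (lincomb ?a ys))" using ca unfolding A .
      also have "\<dots> \<le> 2 * K * (A * (B * lam ?M))" using low A1 K_pos by (intro mult_left_mono) auto
      also have "\<dots> \<le> 2 * K * (A * (B * (A * real ?M powr \<alpha>)))"
        using \<alpha>(4)[OF M1] A1 K_pos leB unfolding A_def by (intro mult_left_mono) auto
      also have "\<dots> = E * real ?M powr \<alpha>" unfolding E_def by (simp add: mult_ac)
      finally show "real ?M powr \<alpha> \<le> E * norm (lincomb ?c ys) \<and> norm (lincomb ?c ys) \<le> E * real ?M powr \<alpha>"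
        using * by simp
    qed
  qed
  then show ?thesis using \<alpha>(1,2) E1 by blast
qed

section \<open>Recognising the unit vector bases\<close>

text \<open>
  The isomorphism is \<open>x \<mapsto> (\<phi> i x)\<close> for functionals \<open>\<phi> i\<close> biorthogonal to \<open>xs\<close>. Each \<open>\<phi> i\<close> is a
  multiple of a single basis coordinate, hence continuous, so the expansion along \<open>xs\<close> extends from the
  span to its closure.
\<close>

lemma equivalent_to_unit_basisI:
  assumes xs: "successive N xs" and A: "0 \<le> A" and B: "0 \<le> B"
    and bounds: "\<And>a. 0 \<le> Nm (length xs) a \<and> Nm (length xs) a \<le> A * norm (lincomb a xs) \<and>
      norm (lincomb a xs) \<le> B * Nm (length xs) a"
  shows "equivalent_to_unit_basis (A * B) Nm xs"
proof -
  define n where "n = length xs"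
  define Y where "Y = closure (span (set xs))"
  note sd = successive_distinct_supp[OF xs, folded n_def]
  define s where "s i = Min (supp e (xs ! i))" for i
  have s: "s i \<in> supp e (xs ! i)" if "i < n" for i
    unfolding s_def
  proof (rule Min_in)
    show "finite (supp e (xs ! i))" using sd(1)[OF that] by (simp add: fin_supp_unit_def)
    have "xs ! i \<noteq> 0" using sd(1)[OF that] by (auto simp: fin_supp_unit_def)
    then show "supp e (xs ! i) \<noteq> {}" by (rule supp_nonempty)
  qed
  define \<phi> where "\<phi> i x = coords e x (s i) / coords e (xs ! i) (s i)" for i x
  have \<phi>lin: "bounded_linear (\<phi> i)" for i
    unfolding \<phi>_def[abs_def] by (rule bounded_linear_divide[THEN bounded_linear_compose, OF bounded_linear_coords])
  have \<phi>xs: "\<phi> i (xs ! j) = (if i = j then 1 else 0)" if "i < n" "j < n" for i j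
  proof (cases "i = j")
    case True
    then show ?thesis using s[OF that(1)] by (simp add: \<phi>_def supp_def)
  next
    case False
    then have "s i \<notin> supp e (xs ! j)" using s[OF that(1)] sd(2)[OF that False] by blast
    then show ?thesis using False by (simp add: \<phi>_def supp_def)
  qed
  note \<phi>l = bounded_linear.linear[OF \<phi>lin]
  define T where "T x = (\<lambda>i. if i < n then \<phi> i x else 0)" for x
  have T_lc: "T (lincomb a xs) = a" if "a \<in> tuples n" for a
  proof
    fix i
    show "T (lincomb a xs) i = a i"
    proof (cases "i < n")
      case True
      have "\<phi> i (lincomb a xs) = (\<Sum>j<n. a j * \<phi> i (xs ! j))"
        by (simp add: lincomb_def linear_sum[OF \<phi>l] linear_scale[OF \<phi>l] n_def)
      also have "\<dots> = (\<Sum>j<n. if i = j then a j else 0)"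
        by (rule sum.cong) (use True \<phi>xs in auto)
      finally show ?thesis using True by (simp add: T_def)
    next
      case False
      then show ?thesis using that by (simp add: T_def tuples_def)
    qed
  qed
  have nth_span: "xs ! j \<in> span (set xs)" if "j < n" for j
    using that by (intro span_base) (simp add: n_def)
  have lcY: "lincomb a xs \<in> Y" for a
    unfolding Y_def lincomb_def
    by (rule closure_subset[THEN subsetD]) (auto intro!: span_sum span_scale nth_span simp: n_def)
  have lc_T: "lincomb (T x) xs = x" if "x \<in> Y" for x
  proof (rule in_closure_span_linear_eq[OF _ bounded_linear_ident _ that[unfolded Y_def]])
    have "(\<lambda>x. lincomb (T x) xs) = (\<lambda>x. \<Sum>i<n. \<phi> i x *\<^sub>R xs ! i)"
      by (auto simp: lincomb_def T_def n_def intro!: sum.cong)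
    then show "bounded_linear (\<lambda>x. lincomb (T x) xs)"
      by (simp add: bounded_linear_sum bounded_linear_scaleR_const \<phi>lin)
    show "lincomb (T x) xs = x" if x: "x \<in> set xs" for x
    proof -
      obtain j where j: "j < n" "x = xs ! j" using x unfolding in_set_conv_nth n_def by blast
      have "lincomb (T x) xs = (\<Sum>i<n. (if i = j then 1 else 0) *\<^sub>R xs ! i)"
        unfolding lincomb_def n_def[symmetric] by (rule sum.cong) (use j \<phi>xs in \<open>auto simp: T_def\<close>)
      also have "\<dots> = (\<Sum>i<n. if i = j then xs ! i else 0)" by (rule sum.cong) auto
      also have "\<dots> = x" using j by simp
      finally show ?thesis .
    qed
  qed
  have Ttup: "T x \<in> tuples n" for x by (simp add: T_def tuples_def)
  have bij: "bij_betw T Y (tuples n)"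
    by (rule bij_betw_byWitness[where f' = "\<lambda>a. lincomb a xs"]) (use lc_T T_lc lcY Ttup in auto)
  have inv: "inv_into Y T a = lincomb a xs" if "a \<in> tuples n" for a
    by (rule inv_into_f_eq) (use bij that lcY T_lc in \<open>auto simp: bij_betw_def\<close>)
  note bd = bounds[folded n_def]
  have 1: "Nm n (T x) / norm x \<le> A" if "x \<in> Y" for x
    using bd[of "T x"] lc_T[OF that] A by (cases "x = 0") (simp_all add: divide_le_eq)
  have 2: "norm (inv_into Y T a) / Nm n a \<le> B" if "a \<in> tuples n" for a
    using bd[of a] inv[OF that] B by (cases "Nm n a = 0") (auto simp: divide_le_eq)
  have bdd1: "bdd_above ((\<lambda>x. Nm n (T x) / norm x) ` Y)" using 1 by (auto intro!: bdd_aboveI2)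
  have bdd2: "bdd_above ((\<lambda>a. norm (inv_into Y T a) / Nm n a) ` tuples n)" using 2 by (auto intro!: bdd_aboveI2)
  have "0 \<in> Y" using lcY[of "\<lambda>_. 0"] by (simp add: lincomb_def)
  have s1: "(SUP x\<in>Y. Nm n (T x) / norm x) \<le> A" using \<open>0 \<in> Y\<close> 1 by (intro cSUP_least) auto
  have s2: "(SUP a\<in>tuples n. norm (inv_into Y T a) / Nm n a) \<le> B"
    using 2 Ttup by (intro cSUP_least) auto
  have "(\<lambda>_. 0) \<in> tuples n" by (simp add: tuples_def)
  \<comment> \<open>The supremum is at least its value at the zero tuple, which is nonnegative.\<close>
  have s0: "0 \<le> (SUP a\<in>tuples n. norm (inv_into Y T a) / Nm n a)"
  proof (rule cSUP_upper2[OF bdd2 \<open>(\<lambda>_. 0) \<in> tuples n\<close>])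
    show "0 \<le> norm (inv_into Y T (\<lambda>_. 0)) / Nm n (\<lambda>_. 0)"
      using bd by (intro divide_nonneg_nonneg) auto
  qed
  have prod: "(SUP x\<in>Y. Nm n (T x) / norm x) * (SUP a\<in>tuples n. norm (inv_into Y T a) / Nm n a) \<le> A * B"
    using s1 s2 s0 A by (intro mult_mono) auto
  have Tadd: "T (x + y) = (\<lambda>i. T x i + T y i)" and Tscale: "T (c *\<^sub>R x) = (\<lambda>i. c * T x i)" for x y c
    using linear_add[OF \<phi>l] linear_scale[OF \<phi>l] by (auto simp: T_def)
  have Tunit: "T (xs ! i) = unit_tuple i" if "i < n" for i
    using that \<phi>xs by (auto simp: T_def unit_tuple_def)
  show ?thesis
    unfolding equivalent_to_unit_basis_def Let_def n_def[symmetric] Y_def[symmetric]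
    by (rule exI[of _ T]) (use Tadd Tscale bij Tunit bdd1 bdd2 prod in blast)
qed

lemma linf_norm_bounds:
  shows "0 \<le> linf_norm n a" and "i < n \<Longrightarrow> \<bar>a i\<bar> \<le> linf_norm n a"
    and "linf_norm n a = 0 \<or> (\<exists>i<n. linf_norm n a = \<bar>a i\<bar>)"
proof -
  let ?S = "insert 0 ((\<lambda>i. \<bar>a i\<bar>) ` {..<n})"
  have f: "finite ?S" by simp
  show "0 \<le> linf_norm n a" "i < n \<Longrightarrow> \<bar>a i\<bar> \<le> linf_norm n a"
    unfolding linf_norm_def by (rule Max_ge[OF f]; simp)+
  have "Max ?S \<in> ?S" by (rule Max_in[OF f]) simp
  then show "linf_norm n a = 0 \<or> (\<exists>i<n. linf_norm n a = \<bar>a i\<bar>)"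
    unfolding linf_norm_def by blast
qed

text \<open>
  If sums of moves are bounded, unconditionality bounds every combination by its largest coefficient; the
  converse estimate holds in any unconditional space.
\<close>

lemma c0_case:
  assumes E: "1 \<le> E" and W: "\<And>n. 1 \<le> n \<Longrightarrow> wins n (\<lambda>ys. norm (block_total ys) \<le> E)"
  shows "asymptotically_c0 e"
  unfolding asymptotically_c0_def
proof (intro exI allI)
  fix n
  have "wins n (\<lambda>ys. norm (block_total ys) \<le> E)"
    using W[of n] E by (cases "n = 0") (auto simp: lincomb_def)
  then show "player_I_wins e n (equivalent_to_unit_basis (K * (2 * K * E)) linf_norm)"
  proof (rule wins_imp_player_I_wins[OF wins_mono[OF wins_conj[OF _ wins_successive[of n 0]]]])
    fix ys :: "'a list" assume n: "length ys = n" and "norm (block_total ys) \<le> E \<and> successive 0 ys"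
    then have ys: "norm (block_total ys) \<le> E" "successive 0 ys" by auto
    show "equivalent_to_unit_basis (K * (2 * K * E)) linf_norm ys"
    proof (rule equivalent_to_unit_basisI[OF ys(2)], goal_cases)
      case 1 show ?case using K_pos by simp
    next
      case 2 show ?case using K_pos E by simp
    next
      case (3 a)
      let ?m = "linf_norm (length ys) a"
      have up: "?m \<le> K * norm (lincomb a ys)"
        using linf_norm_bounds(3)[of "length ys" a] lincomb_coefficient[OF ys(2), of _ a] K_pos by auto
      have "norm (lincomb a ys) \<le> 2 * K * norm (lincomb (\<lambda>i. ?m * 1) ys)"
        by (rule lincomb_mono[OF ys(2)]) (use linf_norm_bounds(1,2) in fastforce)
      also have "\<dots> = 2 * K * (?m * norm (block_total ys))"
        using linf_norm_bounds(1) by (simp only: lincomb_scaleR norm_scaleR abs_of_nonneg)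
      also have "\<dots> \<le> 2 * K * (?m * E)"
        using ys(1) linf_norm_bounds(1) K_pos by (intro mult_left_mono) auto
      finally show ?case using up linf_norm_bounds(1) by (simp add: mult_ac)
    qed
  qed
qed

text \<open>
  Let \<open>k i\<close> be the least integer exceeding \<open>R * \<bar>a i\<bar> powr (1 / \<alpha>)\<close>. After taking the power \<open>\<alpha>\<close>
  the coefficients change by at most 1, which is negligible against \<open>R powr \<alpha>\<close> by the choice of \<open>R\<close>, and the sum of the
  \<open>k i\<close> lies between \<open>R\<close> and \<open>R + n\<close>.
\<close>

lemma lp_bounds_of_power_estimates:
  assumes al: "0 < \<alpha>" "\<alpha> \<le> 1" and E: "1 \<le> E" and ys: "successive 0 ys" and n: "length ys = n"
    and R: "1 \<le> R" "real n \<le> real R" "4 * K * E * real n \<le> real R powr \<alpha>"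
    and pe: "\<And>k. k \<in> {..<n} \<rightarrow>\<^sub>E {1..Suc R} \<Longrightarrow>
      real (\<Sum>i<n. k i) powr \<alpha> \<le> E * norm (lincomb (\<lambda>i. real (k i) powr \<alpha>) ys) \<and>
      norm (lincomb (\<lambda>i. real (k i) powr \<alpha>) ys) \<le> E * real (\<Sum>i<n. k i) powr \<alpha>"
    and a: "(\<Sum>i<n. \<bar>a i\<bar> powr (1 / \<alpha>)) = 1"
  shows "1 \<le> 8 * K^2 * E * norm (lincomb a ys)" "norm (lincomb a ys) \<le> 4 * K * E"
proof -
  let ?t = "\<lambda>i. real R * \<bar>a i\<bar> powr (1 / \<alpha>)"
  define k where "k = restrict (\<lambda>i. nat \<lfloor>?t i\<rfloor> + 1) {..<n}"
  have kb: "?t i \<le> real (k i)" "real (k i) \<le> ?t i + 1" if "i < n" for i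
  proof -
    have "0 \<le> ?t i" by simp
    then have "real (k i) = of_int \<lfloor>?t i\<rfloor> + 1" using that by (simp add: k_def)
    then show "?t i \<le> real (k i)" "real (k i) \<le> ?t i + 1" by linarith+
  qed
  have t_le: "?t i \<le> real R" if "i < n" for i
  proof -
    have "\<bar>a i\<bar> powr (1 / \<alpha>) \<le> (\<Sum>i<n. \<bar>a i\<bar> powr (1 / \<alpha>))"
      by (rule member_le_sum) (use that in auto)
    then show ?thesis using a mult_left_mono[of "\<bar>a i\<bar> powr (1 / \<alpha>)" 1 "real R"] by simp
  qed
  have "k \<in> {..<n} \<rightarrow>\<^sub>E {1..Suc R}"
  proof (rule PiE_I)
    fix i assume i: "i \<in> {..<n}"
    then have "1 \<le> k i" by (simp add: k_def)
    moreover have "real (k i) \<le> real (Suc R)" using kb(2)[of i] t_le[of i] i by simp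
    ultimately show "k i \<in> {1..Suc R}" by simp
  qed (simp add: k_def)
  note p = pe[OF this]
  let ?c = "\<lambda>i. real (k i) powr \<alpha>" and ?M = "\<Sum>i<n. k i" and ?r = "real R powr \<alpha>"
  have rpos: "0 < ?r" using R(1) by simp
  have sumt: "(\<Sum>i<n. ?t i) = real R" using a by (simp add: sum_distrib_left[symmetric])
  have M1: "real R \<le> real ?M" using sum_mono[of "{..<n}" ?t "\<lambda>i. real (k i)"] kb(1) sumt by simp
  have M2: "real ?M \<le> 2 * real R"
    using sum_mono[of "{..<n}" "\<lambda>i. real (k i)" "\<lambda>i. ?t i + 1"] kb(2) sumt R(2)
    by (simp add: sum.distrib)
  have tp: "?t i powr \<alpha> = ?r * \<bar>a i\<bar>" for i
    using al by (simp add: powr_mult powr_powr)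
  have c1: "?r * \<bar>a i\<bar> \<le> ?c i" if "i < n" for i
    unfolding tp[symmetric] by (rule powr_mono2) (use kb(1)[OF that] al in auto)
  have c2: "?c i \<le> ?r * \<bar>a i\<bar> + 1" if "i < n" for i
  proof -
    have "?c i \<le> (?t i + 1) powr \<alpha>" by (rule powr_mono2) (use kb(2)[OF that] al in auto)
    also have "\<dots> \<le> ?t i powr \<alpha> + 1" by (rule powr_add_one_le) (use al in auto)
    finally show ?thesis by (simp only: tp)
  qed
  have ra: "norm (lincomb (\<lambda>i. ?r * a i) ys) = ?r * norm (lincomb a ys)"
    using rpos by (simp add: lincomb_scaleR)
  have "?r * norm (lincomb a ys) \<le> 2 * K * norm (lincomb ?c ys)"
    unfolding ra[symmetric]
  proof (rule lincomb_mono[OF ys])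
    fix i assume "i < length ys"
    then have "?r * \<bar>a i\<bar> \<le> ?c i" using c1 n by simp
    then show "\<bar>?r * a i\<bar> \<le> \<bar>?c i\<bar>" using rpos by (simp add: abs_mult)
  qed
  also have "\<dots> \<le> 2 * K * (E * real ?M powr \<alpha>)"
    using p K_pos by (intro mult_left_mono) auto
  also have "\<dots> \<le> 2 * K * (E * (2 * ?r))"
  proof -
    have "real ?M powr \<alpha> \<le> (2 * real R) powr \<alpha>" by (rule powr_mono2) (use M2 al in \<open>auto intro: sum_nonneg\<close>)
    also have "\<dots> = 2 powr \<alpha> * ?r" by (simp add: powr_mult)
    also have "\<dots> \<le> 2 * ?r"
      using rpos powr_mono[of \<alpha> 1 "2::real"] al by (intro mult_right_mono) auto
    finally show ?thesis using K_pos E by (intro mult_left_mono) auto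
  qed
  finally have "?r * norm (lincomb a ys) \<le> ?r * (4 * K * E)" by (simp add: mult_ac)
  then show "norm (lincomb a ys) \<le> 4 * K * E" using rpos by simp
  have "?r \<le> real ?M powr \<alpha>" by (rule powr_mono2) (use M1 al in auto)
  also have "\<dots> \<le> E * norm (lincomb ?c ys)" using p by simp
  also have "norm (lincomb ?c ys) \<le> norm (lincomb (\<lambda>i. ?r * \<bar>a i\<bar>) ys) + real n"
  proof -
    have "norm (lincomb ?c ys - lincomb (\<lambda>i. ?r * \<bar>a i\<bar>) ys) \<le> (\<Sum>i<n. \<bar>?c i - ?r * \<bar>a i\<bar>\<bar>)"
      unfolding lincomb_diff using norm_lincomb_le[OF ys] n by simp
    also have "\<dots> \<le> (\<Sum>i<n. 1)"
    proof (rule sum_mono)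
      fix i assume "i \<in> {..<n}"
      then show "\<bar>?c i - ?r * \<bar>a i\<bar>\<bar> \<le> 1" using c1[of i] c2[of i] by simp
    qed
    finally have "norm (lincomb ?c ys - lincomb (\<lambda>i. ?r * \<bar>a i\<bar>) ys) \<le> real n" by simp
    then show ?thesis
      using norm_triangle_sub[of "lincomb ?c ys" "lincomb (\<lambda>i. ?r * \<bar>a i\<bar>) ys"] by linarith
  qed
  also have "norm (lincomb (\<lambda>i. ?r * \<bar>a i\<bar>) ys) \<le> 2 * K * (?r * norm (lincomb a ys))"
    unfolding ra[symmetric] by (rule lincomb_mono[OF ys]) (simp add: abs_mult)
  finally have *: "?r \<le> E * (2 * K * (?r * norm (lincomb a ys)) + real n)" using E by simp
  have "E * real n \<le> ?r / 2"
  proof -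
    have "4 * 1 * (E * real n) \<le> 4 * K * (E * real n)"
      using K_ge_1 E by (intro mult_right_mono mult_left_mono) auto
    then have "4 * (E * real n) \<le> ?r" using R(3) by simp
    moreover have "0 \<le> E * real n" using E by simp
    ultimately show ?thesis by linarith
  qed
  then have "?r \<le> ?r * (4 * K * E * norm (lincomb a ys))"
    using * by (simp add: algebra_simps)
  then have "1 \<le> 4 * K * E * norm (lincomb a ys)" using rpos by simp
  also have "\<dots> \<le> (8 * K^2 * E) * norm (lincomb a ys)"
  proof (rule mult_right_mono)
    have "4 * K * E * 1 \<le> 4 * K * E * (2 * K)" using K_ge_1 E by (intro mult_left_mono) auto
    then show "4 * K * E \<le> 8 * K^2 * E" by (simp add: power2_eq_square mult_ac)
  qed simp
  finally show "1 \<le> 8 * K^2 * E * norm (lincomb a ys)" .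
qed

lemma lp_norm_powr:
  assumes "0 < p"
  shows "lp_norm p n a powr p = (\<Sum>i<n. \<bar>a i\<bar> powr p)"
  using assms by (simp add: lp_norm_def powr_powr sum_nonneg)

text \<open>
  For a fixed length only the finitely many integer vectors with entries up to \<open>Suc R\<close> matter, so Player I can
  enforce all their estimates simultaneously; homogeneity covers the remaining coefficients.
\<close>

lemma lp_case:
  assumes al: "0 < \<alpha>" "\<alpha> \<le> 1" and E: "1 \<le> E"
    and W: "\<And>n k. 1 \<le> n \<Longrightarrow> (\<forall>i<n. 1 \<le> k i) \<Longrightarrow>
    wins n (\<lambda>ys. real (\<Sum>i<n. k i) powr \<alpha> \<le> E * norm (lincomb (\<lambda>i. real (k i) powr \<alpha>) ys) \<and>
      norm (lincomb (\<lambda>i. real (k i) powr \<alpha>) ys) \<le> E * real (\<Sum>i<n. k i) powr \<alpha>)"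
  shows "asymptotically_lp (1 / \<alpha>) e"
  unfolding asymptotically_lp_def
proof (intro exI allI)
  fix n
  obtain R0 :: nat where R0: "(4 * K * E * real n + 1) powr (1 / \<alpha>) \<le> real R0" using real_arch_simple by blast
  define R where "R = max (max 1 n) R0"
  have R: "1 \<le> R" "real n \<le> real R" by (auto simp: R_def)
  have R3: "4 * K * E * real n \<le> real R powr \<alpha>"
  proof -
    have "0 \<le> 4 * K * E * real n" using K_pos E by simp
    then have "4 * K * E * real n + 1 = ((4 * K * E * real n + 1) powr (1 / \<alpha>)) powr \<alpha>"
      using al by (simp add: powr_powr)
    also have "\<dots> \<le> real R powr \<alpha>"
      by (rule powr_mono2) (use R0 al in \<open>auto simp: R_def\<close>)
    finally show ?thesis by simp
  qed
  let ?P = "\<lambda>k ys. real (\<Sum>i<n. k i) powr \<alpha> \<le> E * norm (lincomb (\<lambda>i. real (k i) powr \<alpha>) ys) \<and>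
      norm (lincomb (\<lambda>i. real (k i) powr \<alpha>) ys) \<le> E * real (\<Sum>i<n. k i) powr \<alpha>"
  have "wins n (\<lambda>ys. \<forall>k\<in>{..<n} \<rightarrow>\<^sub>E {1..Suc R}. ?P k ys)"
  proof (rule wins_ball)
    show "finite ({..<n} \<rightarrow>\<^sub>E {1..Suc R})" by (intro finite_PiE) auto
    show "wins n (?P k)" if k: "k \<in> {..<n} \<rightarrow>\<^sub>E {1..Suc R}" for k
    proof (cases "n = 0")
      case False
      have "\<forall>i<n. 1 \<le> k i" using k by (fastforce simp: PiE_iff)
      then show ?thesis using W[of n k] False by simp
    qed (simp add: lincomb_def)
  qed
  then show "player_I_wins e n (equivalent_to_unit_basis ((8 * K^2 * E) * (4 * K * E)) (lp_norm (1 / \<alpha>)))"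
  proof (rule wins_imp_player_I_wins[OF wins_mono[OF wins_conj[OF _ wins_successive[of n 0]]]])
    fix ys :: "'a list"
    assume n: "length ys = n" and "(\<forall>k\<in>{..<n} \<rightarrow>\<^sub>E {1..Suc R}. ?P k ys) \<and> successive 0 ys"
    then have pe: "\<And>k. k \<in> {..<n} \<rightarrow>\<^sub>E {1..Suc R} \<Longrightarrow> ?P k ys" and ys: "successive 0 ys" by auto
    note est = lp_bounds_of_power_estimates[OF al E ys n R R3 pe]
    show "equivalent_to_unit_basis ((8 * K^2 * E) * (4 * K * E)) (lp_norm (1 / \<alpha>)) ys"
    proof (rule equivalent_to_unit_basisI[OF ys], goal_cases)
      case 1 show ?case using K_pos E by simp
    next
      case 2 show ?case using K_pos E by simp
    next
      case (3 a)
      let ?m = "lp_norm (1 / \<alpha>) n a"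
      have m0: "0 \<le> ?m" by (simp add: lp_norm_def)
      have mp: "?m powr (1 / \<alpha>) = (\<Sum>i<n. \<bar>a i\<bar> powr (1 / \<alpha>))" by (rule lp_norm_powr) (use al in simp)
      show ?case
      proof (cases "?m = 0")
        case True
        then have "(\<Sum>i<n. \<bar>a i\<bar> powr (1 / \<alpha>)) = 0" using mp by simp
        then have "\<And>i. i < n \<Longrightarrow> a i = 0" by (subst (asm) sum_nonneg_eq_0_iff) auto
        then have "lincomb a ys = 0" using n by (simp add: lincomb_def)
        then show ?thesis using True n by simp
      next
        case False
        then have mpos: "0 < ?m" using m0 by simp
        let ?b = "\<lambda>i. (1 / ?m) * a i"
        have "(\<Sum>i<n. \<bar>?b i\<bar> powr (1 / \<alpha>)) = (\<Sum>i<n. \<bar>a i\<bar> powr (1 / \<alpha>) / ?m powr (1 / \<alpha>))"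
          using mpos by (intro sum.cong) (auto simp: abs_mult powr_divide)
        also have "\<dots> = 1" using mpos by (simp add: sum_divide_distrib[symmetric] mp[symmetric])
        finally have b: "(\<Sum>i<n. \<bar>?b i\<bar> powr (1 / \<alpha>)) = 1" .
        have nb: "norm (lincomb ?b ys) = norm (lincomb a ys) / ?m"
          using mpos by (simp only: lincomb_scaleR) simp
        show ?thesis using est[OF _ b] mpos n pe unfolding nb by (simp add: field_simps)
      qed
    qed
  qed
qed

end

section \<open>The dichotomy\<close>

theorem corollary18:
  fixes e :: "nat \<Rightarrow> 'a::banach"
  assumes "unconditional_basis e"
    and "\<And>Y. block_subspace e Y \<Longrightarrow> complemented Y"
  shows "asymptotically_c0 e \<or> (\<exists>p\<ge>1. asymptotically_lp p e)"
proof -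
  obtain K where K: "1 \<le> K"
    "\<And>x F. finite F \<Longrightarrow> norm (\<Sum>i\<in>F. coords e x i *\<^sub>R e i) \<le> K * norm x"
    using unconditional_constant[OF assms(1)] by blast
  interpret unconditional_space e K
    by unfold_locales (use assms(1) K in \<open>auto simp: unconditional_basis_def\<close>)
  have "\<exists>\<alpha> E. 0 \<le> \<alpha> \<and> \<alpha> \<le> 1 \<and> 1 \<le> E \<and> (\<forall>n k. 1 \<le> n \<and> (\<forall>i<n. 1 \<le> k i) \<longrightarrow>
    wins n (\<lambda>ys. real (\<Sum>i<n. k i) powr \<alpha> \<le> E * norm (lincomb (\<lambda>i. real (k i) powr \<alpha>) ys) \<and>
      norm (lincomb (\<lambda>i. real (k i) powr \<alpha>) ys) \<le> E * real (\<Sum>i<n. k i) powr \<alpha>))"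
    by (rule power_estimate[OF assms(2)])
  then obtain \<alpha> E where \<alpha>: "0 \<le> \<alpha>" "\<alpha> \<le> 1" and E: "1 \<le> E"
    and W: "\<forall>n k. 1 \<le> n \<and> (\<forall>i<n. 1 \<le> k i) \<longrightarrow>
    wins n (\<lambda>ys. real (\<Sum>i<n. k i) powr \<alpha> \<le> E * norm (lincomb (\<lambda>i. real (k i) powr \<alpha>) ys) \<and>
      norm (lincomb (\<lambda>i. real (k i) powr \<alpha>) ys) \<le> E * real (\<Sum>i<n. k i) powr \<alpha>)"
    by (elim exE conjE)
  show ?thesis
  proof (cases "\<alpha> = 0")
    case True
    have "asymptotically_c0 e"
    proof (rule c0_case[OF E])
      fix n :: nat assume n: "1 \<le> n"
      \<comment> \<open>For \<open>\<alpha> = 0\<close> and \<open>k i = 1\<close> the power estimate bounds the plain sum of the moves.\<close>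
      have "wins n (\<lambda>ys. real (\<Sum>i<n. 1) powr \<alpha> \<le> E * norm (lincomb (\<lambda>i. real 1 powr \<alpha>) ys) \<and>
        norm (lincomb (\<lambda>i. real 1 powr \<alpha>) ys) \<le> E * real (\<Sum>i<n. 1) powr \<alpha>)"
        using W[rule_format, of n "\<lambda>_. 1"] n by simp
      then show "wins n (\<lambda>ys. norm (block_total ys) \<le> E)"
        by (rule wins_mono) (use True n in auto)
    qed
    then show ?thesis ..
  next
    case False
    then have "0 < \<alpha>" using \<alpha> by simp
    have "asymptotically_lp (1 / \<alpha>) e"
      by (rule lp_case[OF \<open>0 < \<alpha>\<close> \<alpha>(2) E]) (use W in blast)
    moreover have "1 \<le> 1 / \<alpha>" using \<open>0 < \<alpha>\<close> \<alpha>(2) by simp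
    ultimately show ?thesis by blast
  qed
qed

end
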